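(* Let $A\in\mathcal{K}$ be a Koch type set with base segment $A_{0,1}$, and let $$\gamma_1^A=\sup\{a:\mathcal{H}^1(\{x\in A_{0,1}:\tilde\theta_x\ge a\})>0\},\qquad \gamma_2^A=\sup_{x\in A_{0,1}}\tilde\theta_x .$$ Put $f(\gamma)=\frac12\tan\gamma$ and $f_1(\gamma)=-\dfrac{\ln2}{\ln\left(\frac12(1+(\tan\gamma)^2)^{1/2}\right)}$. Then $$\dim\Gamma_{f(\gamma_1^A)}=f_1(\gamma_1^A)\le\dim A\le f_1(\gamma_2^A)=\dim\Gamma_{f(\gamma_2^A)} .$$ Moreover, if either for all $C\subset A_{0,1}$ the implication $\mathcal{H}^1(C)=0\Rightarrow\mathcal{H}^1(\mathcal{F}(C))=0$ holds, or $\mathcal{H}^1(\Upsilon_{\gamma_1^A+})=0$, then $\dim A=f_1(\gamma_1^A)$.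
   Context: $\dim$ denotes Hausdorff dimension. A triangular cap on a segment is a closed solid isosceles triangle having that segment as base; its base angle is either of its two equal angles. Koch type sets: let $A_{0,1}\subset\mathbb{R}^2$ be a segment of finite positive length, and $T_{0,1}$ a triangular cap on it of height $\varepsilon\mathcal{H}^1(A_{0,1})$ with $0<\varepsilon<1/100$ and base angle $\theta_{0,1}$. Inductively, given caps $T_{n,i}$ on segments $A_{n,i}$ with base angles $\theta_{n,i}$ ($1\le i\le2^n$), let $A_{n+1,2i-1},A_{n+1,2i}$ be the two edges of $T_{n,i}$ other than its base, numbered so that $A_{n+1,1},\dots,A_{n+1,2^{n+1}}$ are consecutive segments of a polygonal curve joining the end points of $A_{0,1}$ (always starting from the same end point), and for $k\in\{2i-1,2i\}$ let $T_{n+1,k}\subset T_{n,i}$ be a triangular cap on $A_{n+1,k}$ with base angle $\theta_{n+1,k}\le\theta_{n,i}$. Let $B=\bigcap_{n=0}^\infty\bigcup_{i=1}^{2^n}T_{n,i}$ and let $E(B)$ be the set of all vertices of all $T_{n,i}$. A Koch type set is any set $A\in\{B,B\setminus E(B)\}$ arising in this way; $\mathcal{K}$ is the collection of all of them. Parametrisation: let $D_{n,1},\dots,D_{n,2^n}$ be the $2^n$ consecutive closed subsegments of $A_{0,1}$ of equal length (numbered from the same end point), and $F_n:A_{0,1}\to\mathbb{R}^2$ the continuous map taking each $D_{n,i}$ affinely onto $A_{n,i}$ in the order-preserving way. The limit $\mathcal{F}=\lim_{n\to\infty}F_n$ exists pointwise and is a bijection of $A_{0,1}$ onto $B$ with $\mathcal{F}(D_{n,i})\subset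 T_{n,i}$. For $x\in A_{0,1}$ let $i(n,x)$ be the index $i$ with $\mathcal{F}(x)\in T_{n,i}$ (the larger one if there are two, which happens only when $\mathcal{F}(x)\in E(B)$), and $\tilde\theta_x=\lim_{n\to\infty}\theta_{n,i(n,x)}$. For $a\in\mathbb{R}$, $\Upsilon_{a+}:=\mathcal{F}(\{x\in A_{0,1}:\tilde\theta_x\ge a\})$. For $0<\eta<1/100$, $\Gamma_\eta$ is the following set. Let $U_{0,1}$ be the triangular cap of height $\eta$ on the segment $[(0,0),(1,0)]$ whose apex has positive second coordinate; its base angle is $\tan^{-1}(2\eta)$. Inductively, given triangular caps $U_{n,i}$ ($1\le i\le2^n$) with base angle $\tan^{-1}(2\eta)$, let $U_{n+1,2i-1},U_{n+1,2i}\subset U_{n,i}$ be the triangular caps with the same base angle $\tan^{-1}(2\eta)$ on the two edges of $U_{n,i}$ other than its base. Then $\Gamma_\eta=\bigcap_{n=0}^\infty\bigcup_{i=1}^{2^n}U_{n,i}$. $\Gamma_0$ is the segment $[(0,0),(1,0)]$. *)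

theory Defs
  imports "HOL-Analysis.Analysis"
begin

section \<open>Hausdorff measure and dimension\<close>

text \<open>Normalised so that in dimension one the measure is length. \<open>0 powr 0 = 0\<close> in HOL, so the
  convention that a nonempty set has zeroth diameter power one is spelled out. Coverings are required
  to be bounded because \<^const>\<open>diameter\<close> is unspecified on unbounded sets.\<close>

definition diam_power :: "real \<Rightarrow> 'a::metric_space set \<Rightarrow> ennreal" where
  "diam_power s C =
     (if C = {} then 0 else if s = 0 then 1 else ennreal (diameter C powr s))"

definition hausdorff_premeasure :: "real \<Rightarrow> real \<Rightarrow> 'a::metric_space set \<Rightarrow> ennreal" where
  "hausdorff_premeasure s \<delta> A =
     (INF C \<in> {C :: nat \<Rightarrow> 'a set. A \<subseteq> (\<Union>j. C j) \<and> (\<forall>j. bounded (C j) \<and> diameter (C j) \<le> \<delta>)}.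
        (\<Sum>j. diam_power s (C j)))"

definition hausdorff_measure :: "real \<Rightarrow> 'a::metric_space set \<Rightarrow> ennreal" where
  "hausdorff_measure s A = (SUP \<delta> \<in> {0<..}. hausdorff_premeasure s \<delta> A)"

definition hausdorff_dim :: "'a::metric_space set \<Rightarrow> ereal" where
  "hausdorff_dim A = (INF s \<in> {s. 0 \<le> s \<and> hausdorff_measure s A = 0}. ereal s)"


section \<open>Triangular caps\<close>

text \<open>The plane is \<^typ>\<open>real \<times> real\<close>, whose metric is Euclidean. A cap on the segment from
  \<open>a\<close> to \<open>b\<close> is given by its apex \<open>v\<close>.\<close>

definition is_cap_apex :: "real \<times> real \<Rightarrow> real \<times> real \<Rightarrow> real \<times> real \<Rightarrow> bool" where
  "is_cap_apex a b v \<longleftrightarrow> \<not> collinear {a, b, v} \<and> dist a v = dist b v"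

definition cap_height :: "real \<times> real \<Rightarrow> real \<times> real \<Rightarrow> real \<times> real \<Rightarrow> real" where
  "cap_height a b v = infdist v (affine hull {a, b})"

text \<open>The angle of the triangle at \<open>a\<close>.\<close>

definition cap_base_angle :: "real \<times> real \<Rightarrow> real \<times> real \<Rightarrow> real \<times> real \<Rightarrow> real" where
  "cap_base_angle a b v = arccos (((b - a) \<bullet> (v - a)) / (norm (b - a) * norm (v - a)))"

text \<open>A nested family of caps is encoded by the vertices \<open>p n 0, \<dots>, p n (2^n)\<close> of its polygonal
  curves, listed from the fixed end point \<open>p 0 0\<close>; for \<open>1 \<le> i \<le> 2^n\<close> the base \<open>A\<^sub>n\<^sub>,\<^sub>i\<close> joins
  \<open>p n (i - 1)\<close> to \<open>p n i\<close>. The next curve passes through the same vertices with the apices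
  inserted between them, so the apex of \<open>T\<^sub>n\<^sub>,\<^sub>i\<close> is \<open>p (n + 1) (2i - 1)\<close>. Values \<open>p n j\<close> with
  \<open>j > 2^n\<close> are irrelevant.\<close>

definition apex :: "(nat \<Rightarrow> nat \<Rightarrow> real \<times> real) \<Rightarrow> nat \<Rightarrow> nat \<Rightarrow> real \<times> real" where
  "apex p n i = p (Suc n) (2 * i - 1)"

definition base :: "(nat \<Rightarrow> nat \<Rightarrow> real \<times> real) \<Rightarrow> nat \<Rightarrow> nat \<Rightarrow> (real \<times> real) set" where
  "base p n i = closed_segment (p n (i - 1)) (p n i)"

definition cap :: "(nat \<Rightarrow> nat \<Rightarrow> real \<times> real) \<Rightarrow> nat \<Rightarrow> nat \<Rightarrow> (real \<times> real) set" where
  "cap p n i = convex hull {p n (i - 1), p n i, apex p n i}"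

definition base_angle :: "(nat \<Rightarrow> nat \<Rightarrow> real \<times> real) \<Rightarrow> nat \<Rightarrow> nat \<Rightarrow> real" where
  "base_angle p n i = cap_base_angle (p n (i - 1)) (p n i) (apex p n i)"

definition nested_caps :: "(nat \<Rightarrow> nat \<Rightarrow> real \<times> real) \<Rightarrow> bool" where
  "nested_caps p \<longleftrightarrow>
     p 0 0 \<noteq> p 0 1 \<and>
     (\<forall>n. \<forall>j \<le> 2^n. p (Suc n) (2 * j) = p n j) \<and>
     (\<forall>n. \<forall>i \<in> {1..2^n}. is_cap_apex (p n (i - 1)) (p n i) (apex p n i)) \<and>
     (\<forall>n. \<forall>i \<in> {1..2^n}. \<forall>k \<in> {2 * i - 1, 2 * i}. cap p (Suc n) k \<subseteq> cap p n i)"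

definition cap_limit :: "(nat \<Rightarrow> nat \<Rightarrow> real \<times> real) \<Rightarrow> (real \<times> real) set" where
  "cap_limit p = (\<Inter>n. \<Union>i \<in> {1..2^n}. cap p n i)"

definition cap_vertices :: "(nat \<Rightarrow> nat \<Rightarrow> real \<times> real) \<Rightarrow> (real \<times> real) set" where
  "cap_vertices p = (\<Union>n. \<Union>i \<in> {1..2^n}. {p n (i - 1), p n i, apex p n i})"


section \<open>Koch type sets\<close>

definition koch_caps :: "(nat \<Rightarrow> nat \<Rightarrow> real \<times> real) \<Rightarrow> bool" where
  "koch_caps p \<longleftrightarrow>
     nested_caps p \<and>
     (\<exists>\<epsilon>::real. 0 < \<epsilon> \<and> \<epsilon> < 1/100 \<and>
        ennreal (cap_height (p 0 0) (p 0 1) (apex p 0 1)) = ennreal \<epsilon> * hausdorff_measure 1 (base p 0 1)) \<and>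
     (\<forall>n. \<forall>i \<in> {1..2^n}. \<forall>k \<in> {2 * i - 1, 2 * i}. base_angle p (Suc n) k \<le> base_angle p n i)"

text \<open>\<open>A\<close> is a Koch type set arising from the caps encoded by \<open>p\<close>.\<close>

definition koch_type_set :: "(nat \<Rightarrow> nat \<Rightarrow> real \<times> real) \<Rightarrow> (real \<times> real) set \<Rightarrow> bool" where
  "koch_type_set p A \<longleftrightarrow>
     koch_caps p \<and> A \<in> {cap_limit p, cap_limit p - cap_vertices p}"

text \<open>The segment \<open>D\<^sub>n\<^sub>,\<^sub>i\<close> joins \<open>subdivision p n (i - 1)\<close> to \<open>subdivision p n i\<close>.\<close>

definition subdivision :: "(nat \<Rightarrow> nat \<Rightarrow> real \<times> real) \<Rightarrow> nat \<Rightarrow> nat \<Rightarrow> real \<times> real" where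
  "subdivision p n j = p 0 0 + (real j / 2^n) *\<^sub>R (p 0 1 - p 0 0)"

definition polygon_map :: "(nat \<Rightarrow> nat \<Rightarrow> real \<times> real) \<Rightarrow> nat \<Rightarrow> real \<times> real \<Rightarrow> real \<times> real" where
  "polygon_map p n x =
     (THE y. \<exists>i \<in> {1..2^n}. \<exists>t \<in> {0..1}.
        x = (1 - t) *\<^sub>R subdivision p n (i - 1) + t *\<^sub>R subdivision p n i \<and>
        y = (1 - t) *\<^sub>R p n (i - 1) + t *\<^sub>R p n i)"

definition koch_map :: "(nat \<Rightarrow> nat \<Rightarrow> real \<times> real) \<Rightarrow> real \<times> real \<Rightarrow> real \<times> real" where
  "koch_map p x = lim (\<lambda>n. polygon_map p n x)"

definition cap_index :: "(nat \<Rightarrow> nat \<Rightarrow> real \<times> real) \<Rightarrow> nat \<Rightarrow> real \<times> real \<Rightarrow> nat" where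
  "cap_index p n x = Max {i \<in> {1..2^n}. koch_map p x \<in> cap p n i}"

definition limit_angle :: "(nat \<Rightarrow> nat \<Rightarrow> real \<times> real) \<Rightarrow> real \<times> real \<Rightarrow> real" where
  "limit_angle p x = lim (\<lambda>n. base_angle p n (cap_index p n x))"

definition upsilon :: "(nat \<Rightarrow> nat \<Rightarrow> real \<times> real) \<Rightarrow> real \<Rightarrow> (real \<times> real) set" where
  "upsilon p a = koch_map p ` {x \<in> base p 0 1. limit_angle p x \<ge> a}"

definition gamma1 :: "(nat \<Rightarrow> nat \<Rightarrow> real \<times> real) \<Rightarrow> real" where
  "gamma1 p = Sup {a. hausdorff_measure 1 {x \<in> base p 0 1. limit_angle p x \<ge> a} > 0}"

definition gamma2 :: "(nat \<Rightarrow> nat \<Rightarrow> real \<times> real) \<Rightarrow> real" where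
  "gamma2 p = (SUP x \<in> base p 0 1. limit_angle p x)"


section \<open>The Koch curves with constant base angle\<close>

definition const_caps :: "real \<Rightarrow> (nat \<Rightarrow> nat \<Rightarrow> real \<times> real) \<Rightarrow> bool" where
  "const_caps \<eta> u \<longleftrightarrow>
     nested_caps u \<and>
     u 0 0 = (0, 0) \<and> u 0 1 = (1, 0) \<and>
     cap_height (u 0 0) (u 0 1) (apex u 0 1) = \<eta> \<and> snd (apex u 0 1) > 0 \<and>
     (\<forall>n. \<forall>i \<in> {1..2^n}. base_angle u n i = arctan (2 * \<eta>))"

text \<open>Intended for \<open>0 \<le> \<eta> < 1/100\<close>; for \<open>\<eta> > 0\<close> the conditions determine all the caps, hence the
  limit set.\<close>

definition Koch_curve :: "real \<Rightarrow> (real \<times> real) set" where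
  "Koch_curve \<eta> =
     (if \<eta> = 0 then closed_segment (0, 0) (1, 0)
      else (THE S. \<exists>u. const_caps \<eta> u \<and> S = cap_limit u))"

definition koch_f :: "real \<Rightarrow> real" where
  "koch_f \<gamma> = 1/2 * tan \<gamma>"

definition koch_f1 :: "real \<Rightarrow> real" where
  "koch_f1 \<gamma> = - (ln 2 / ln (1/2 * sqrt (1 + (tan \<gamma>)\<^sup>2)))"

end

theory Submission
  imports Defs
begin

text \<open>If all base angles met along the way to \<open>x\<close> and \<open>y\<close> are at least \<open>\<gamma>\<close>, the bases shrink at most by
  the factor \<open>\<rho> = 1 / (2 cos \<gamma>)\<close> per level, while parameter intervals are halved. Since the two
  children of a cap meet at an obtuse angle, and one child stays away from the far end of the base,
  this gives \<open>\<bar>x - y\<bar> \<le> C \<bar>F x - F y\<bar>\<^sup>s\<close> with \<open>s = f\<^sub>1(\<gamma>)\<close>, that is \<open>2 \<rho>\<^sup>s = 1\<close>; hence \<open>F\<close> maps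
  sets of positive length on which the limit angle is at least \<open>\<gamma>\<close> to sets of positive
  \<open>s\<close>-dimensional measure. Conversely every non-vertex of the limit set whose limit angle is below
  \<open>\<gamma>\<close> lies in one of countably many caps with base angle at most \<open>\<gamma>\<close>, and covering by the
  descendants of such a cap bounds the dimension of its part of the set by \<open>f\<^sub>1(\<gamma>)\<close>. The vertices
  are countable, and continuity of \<open>f\<^sub>1\<close> allows passing to \<open>\<gamma>\<^sub>1\<close> and \<open>\<gamma>\<^sub>2\<close>.\<close>

section \<open>Null sets of Hausdorff measures\<close>

text \<open>The dimension depends only on which exponents give measure zero, so the argument is
  phrased through null sets, and the only measure computed is the length of a segment. The obstacle
  lies in the lower bound: caps sharing a vertex come arbitrarily close to each other there, so two
  images may be much closer than the caps around them are wide. The remedy is to measure both images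
  from the vertex \<open>v\<close> at which their paths first separate. Obtuseness at
  \<open>v\<close> makes both distances to \<open>v\<close> at most the distance of the images, and
  each is compared with the base at the last level where the path still touches \<open>v\<close>.
  The bound 1/100 enters here: base angles never grow, so all heights stay within 1/100 of their
  bases and every estimate is that of a flat triangle with tiny errors. In the final claim, either
  alternative makes the part of limit angle at least \<open>a\<close> have zero length, for some
  \<open>a\<close> equal or close to the first critical angle. Since \<open>koch_f1\<close> is at
  least 1, zero length gives measure zero at every exponent above it.\<close>

lemma diameter_le_dist:
  assumes "0 \<le> d" "\<And>x y. x \<in> S \<Longrightarrow> y \<in> S \<Longrightarrow> dist x y \<le> d"
  shows "diameter S \<le> d"
proof (cases "S = {}")
  case False
  then have "(SUP (x,y)\<in>S\<times>S. dist x y) \<le> d" using assms by (intro cSUP_least) auto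
  then show ?thesis using False by (simp add: diameter_def)
qed (use assms in simp)

text \<open>Closed balls are convex, so the ball about a point of \<open>S\<close> contains the
  hull; then \<open>S\<close> lies in the ball about any hull point \<open>y\<close>, and so does
  the hull.\<close>

lemma convex_hull_dist_le:
  fixes S :: "'a::real_normed_vector set"
  assumes S: "\<And>x y. x \<in> S \<Longrightarrow> y \<in> S \<Longrightarrow> dist x y \<le> d"
    and xy: "x \<in> convex hull S" "y \<in> convex hull S"
  shows "dist x y \<le> d"
proof -
  have 1: "convex hull S \<subseteq> cball z d" if "z \<in> S" for z
    using S that by (intro hull_minimal) auto
  have "convex hull S \<subseteq> cball y d"
    using 1 xy(2) by (intro hull_minimal) (auto simp: dist_commute subset_eq)
  then show ?thesis using xy(1) by (auto simp: dist_commute)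
qed

text \<open>The cut-off at \<open>N - 1\<close> concerns \<open>u = 1\<close>, where the floor would
  give \<open>N\<close>. Strictness can fail only on the last subinterval; this half-open choice
  later agrees with taking the larger cap index at a vertex.\<close>

lemma subinterval_index:
  fixes u :: real
  assumes "0 \<le> u" "u \<le> 1" "0 < N"
  defines "j \<equiv> min (nat \<lfloor>u * N\<rfloor>) (N - 1)"
  shows "j < N" "real j \<le> u * N" "u * N \<le> real j + 1" "Suc j < N \<Longrightarrow> u * N < real j + 1"
proof -
  have 1: "real (nat \<lfloor>u * N\<rfloor>) \<le> u * N" "u * N < real (nat \<lfloor>u * N\<rfloor>) + 1"
    using assms by (simp_all add: of_nat_floor)
  have 2: "u * N \<le> N" using assms by (simp add: mult_left_le_one_le)
  show "j < N" "real j \<le> u * N" "u * N \<le> real j + 1" "Suc j < N \<Longrightarrow> u * N < real j + 1"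
    using assms(3) 1 2 by (auto simp: j_def min_def of_nat_diff)
qed

lemma hausdorff_null_iff:
  "hausdorff_measure s A = 0 \<longleftrightarrow>
    (\<forall>\<delta>>0. \<forall>e>0. \<exists>C. A \<subseteq> (\<Union>j. C j) \<and> (\<forall>j. bounded (C j) \<and> diameter (C j) \<le> \<delta>) \<and>
       (\<Sum>j. diam_power s (C j)) < e)"
proof -
  have "hausdorff_measure s A = 0 \<longleftrightarrow> (\<forall>\<delta>>0. hausdorff_premeasure s \<delta> A = bot)"
    by (auto simp: hausdorff_measure_def SUP_eq_iff simp flip: bot_ennreal)
  also have "\<dots> \<longleftrightarrow> (\<forall>\<delta>>0. \<forall>e>0. \<exists>C. A \<subseteq> (\<Union>j. C j) \<and>
       (\<forall>j. bounded (C j) \<and> diameter (C j) \<le> \<delta>) \<and> (\<Sum>j. diam_power s (C j)) < e)"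
    unfolding hausdorff_premeasure_def INF_eq_bot_iff by (simp add: conj_assoc bot_ennreal)
  finally show ?thesis .
qed

lemma hausdorff_measure_mono:
  assumes "A \<subseteq> B" shows "hausdorff_measure s A \<le> hausdorff_measure s B"
proof -
  have "hausdorff_premeasure s \<delta> A \<le> hausdorff_premeasure s \<delta> B" for \<delta>
    unfolding hausdorff_premeasure_def using assms by (rule_tac INF_superset_mono) auto
  then show ?thesis unfolding hausdorff_measure_def by (rule SUP_mono')
qed

lemma hausdorff_null_subset:
  "hausdorff_measure s B = 0 \<Longrightarrow> A \<subseteq> B \<Longrightarrow> hausdorff_measure s A = 0"
  using hausdorff_measure_mono by (metis le_zero_eq)

lemma hausdorff_null_UN:
  fixes A :: "nat \<Rightarrow> 'a::metric_space set"
  assumes "\<And>n. hausdorff_measure s (A n) = 0"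
  shows "hausdorff_measure s (\<Union>n. A n) = 0"
  unfolding hausdorff_null_iff
proof (intro allI impI)
  fix \<delta> :: real and e :: ennreal assume "0 < \<delta>" "0 < e"
  then obtain e' where e': "0 < e'" "e' < e" using dense by blast
  then obtain r where r: "e' = ennreal r" "0 < r"
    by (cases e') (auto simp: ennreal_less_zero_iff)
  have "\<forall>n. \<exists>C. A n \<subseteq> (\<Union>j. C j) \<and> (\<forall>j. bounded (C j) \<and> diameter (C j) \<le> \<delta>) \<and>
     (\<Sum>j. diam_power s (C j)) < ennreal (r * (1/2)^Suc n)"
    using assms \<open>0 < \<delta>\<close> r unfolding hausdorff_null_iff by (simp add: ennreal_less_zero_iff)
  then obtain C where C: "\<And>n. A n \<subseteq> (\<Union>j. C n j)" "\<And>n j. bounded (C n j) \<and> diameter (C n j) \<le> \<delta>"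
     "\<And>n. (\<Sum>j. diam_power s (C n j)) < ennreal (r * (1/2)^Suc n)" by metis
  define D where "D = (\<lambda>(n, j). C n j) \<circ> prod_decode"
  have "(\<Union>n. A n) \<subseteq> (\<Union>j. D j)"
  proof
    fix x assume "x \<in> (\<Union>n. A n)"
    then obtain n j where "x \<in> C n j" using C(1) by blast
    then have "x \<in> D (prod_encode (n, j))" by (simp add: D_def)
    then show "x \<in> (\<Union>j. D j)" by blast
  qed
  moreover have "bounded (D j) \<and> diameter (D j) \<le> \<delta>" for j
    using C(2) by (simp add: D_def split: prod.split)
  moreover have "(\<Sum>j. diam_power s (D j)) < e"
  proof -
    have "(\<Sum>j. diam_power s (D j)) = (\<Sum>n. \<Sum>j. diam_power s (C n j))"
      using suminf_ennreal_2dimen[of "\<lambda>n. \<Sum>j. diam_power s (C n j)" "\<lambda>(n,j). diam_power s (C n j)"]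
      by (simp add: D_def case_prod_unfold)
    also have "\<dots> \<le> (\<Sum>n. ennreal (r * (1/2)^Suc n))"
      using C(3) by (intro suminf_le) (auto intro: less_imp_le)
    also have "\<dots> = ennreal (r * 1)"
      using r by (intro suminf_ennreal_eq sums_mult power_half_series) auto
    finally show ?thesis using e' r by simp
  qed
  ultimately show "\<exists>C. (\<Union>n. A n) \<subseteq> (\<Union>j. C j) \<and>
      (\<forall>j. bounded (C j) \<and> diameter (C j) \<le> \<delta>) \<and> (\<Sum>j. diam_power s (C j)) < e" by blast
qed

lemma hausdorff_null_Un:
  assumes "hausdorff_measure s A = 0" "hausdorff_measure s B = 0"
  shows "hausdorff_measure s (A \<union> B) = 0"
proof -
  have "A \<union> B = (\<Union>n::nat. if n = 0 then A else B)" by (auto split: if_splits)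
  moreover have "hausdorff_measure s (if n = 0 then A else B) = 0" for n :: nat
    using assms by simp
  ultimately show ?thesis using hausdorff_null_UN[of s "\<lambda>n. if n = 0 then A else B"] by simp
qed

lemma hausdorff_null_empty [simp]: "hausdorff_measure s {} = 0"
  unfolding hausdorff_null_iff
proof (intro allI impI)
  fix \<delta> :: real and e :: ennreal assume "0 < \<delta>" "0 < e"
  then show "\<exists>C. {} \<subseteq> (\<Union>j. C j) \<and> (\<forall>j. bounded (C j) \<and> diameter (C j) \<le> \<delta>) \<and>
      (\<Sum>j. diam_power s (C j)) < e"
    by (intro exI[of _ "\<lambda>_. {}"]) (simp add: diam_power_def)
qed

lemma hausdorff_null_countable_UN:
  assumes "countable I" "\<And>i. i \<in> I \<Longrightarrow> hausdorff_measure s (A i) = 0"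
  shows "hausdorff_measure s (\<Union>i\<in>I. A i) = 0"
proof (cases "I = {}")
  case False
  then have "(\<Union>i\<in>I. A i) = (\<Union>n. A (from_nat_into I n))"
    by (metis UN_extend_simps(10) assms(1) range_from_nat_into)
  moreover have "hausdorff_measure s (A (from_nat_into I n)) = 0" for n
    using assms(2) from_nat_into[OF False] .
  ultimately show ?thesis by (simp add: hausdorff_null_UN)
qed simp

lemma hausdorff_null_countable:
  assumes "countable A" "s > 0" shows "hausdorff_measure s A = 0"
proof -
  have "hausdorff_measure s {x} = 0" for x :: 'a
    unfolding hausdorff_null_iff
  proof (intro allI impI)
    fix \<delta> :: real and e :: ennreal assume "0 < \<delta>" "0 < e"
    then show "\<exists>C. {x} \<subseteq> (\<Union>j. C j) \<and> (\<forall>j. bounded (C j) \<and> diameter (C j) \<le> \<delta>) \<and>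
      (\<Sum>j. diam_power s (C j)) < e"
      using \<open>s > 0\<close> by (intro exI[of _ "\<lambda>_. {x}"]) (auto simp: diam_power_def)
  qed
  then have "hausdorff_measure s (\<Union>x\<in>A. {x}) = 0"
    using assms by (intro hausdorff_null_countable_UN) auto
  then show ?thesis by simp
qed

text \<open>Covers are taken with diameters at most 1, where powers decrease in the exponent. For
  \<open>s = 0\<close> every nonempty set counts 1, which still dominates its \<open>t\<close>-th
  power.\<close>

lemma hausdorff_null_exponent_mono:
  assumes "hausdorff_measure s A = 0" "0 \<le> s" "s \<le> t"
  shows "hausdorff_measure t A = 0"
  unfolding hausdorff_null_iff
proof (intro allI impI)
  fix \<delta> :: real and e :: ennreal assume "0 < \<delta>" "0 < e"
  then obtain C where C: "A \<subseteq> (\<Union>j. C j)" "\<And>j. bounded (C j) \<and> diameter (C j) \<le> min \<delta> 1"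
     "(\<Sum>j. diam_power s (C j)) < e"
    using assms(1) unfolding hausdorff_null_iff by (metis min_less_iff_conj zero_less_one)
  have "diam_power t (C j) \<le> diam_power s (C j)" for j
  proof -
    have "0 \<le> diameter (C j)" "diameter (C j) \<le> 1" using C(2) by (auto intro: diameter_ge_0)
    then show ?thesis
      using assms(2,3) powr_mono'[of s t "diameter (C j)"] powr_le1[of t "diameter (C j)"]
      by (auto simp: diam_power_def intro!: ennreal_leI simp flip: ennreal_1)
  qed
  then have "(\<Sum>j. diam_power t (C j)) < e"
    using C(3) by (meson le_less_trans suminf_le summableI)
  then show "\<exists>C. A \<subseteq> (\<Union>j. C j) \<and> (\<forall>j. bounded (C j) \<and> diameter (C j) \<le> \<delta>) \<and>
      (\<Sum>j. diam_power t (C j)) < e"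
    using C by (intro exI[of _ C]) auto
qed

text \<open>Serves the degenerate curve, a segment: finite length has to force measure zero at
  exponents above one.\<close>

lemma hausdorff_null_of_finite:
  assumes fin: "hausdorff_measure s A < \<infinity>" and st: "0 < s" "s < t"
  shows "hausdorff_measure t A = 0"
  unfolding hausdorff_null_iff
proof (intro allI impI)
  fix \<delta> :: real and e :: ennreal assume "0 < \<delta>" "0 < e"
  then obtain e' where e': "0 < e'" "e' < e" using dense by blast
  then obtain r where r: "e' = ennreal r" "0 < r"
    by (cases e') (auto simp: ennreal_less_zero_iff)
  obtain M where M: "0 < M" "hausdorff_measure s A < ennreal M"
  proof -
    obtain h where h: "hausdorff_measure s A = ennreal h" "0 \<le> h"
      using fin by (cases "hausdorff_measure s A") auto
    show ?thesis by (rule that[of "h + 1"]) (use h in \<open>auto simp: ennreal_less_iff\<close>)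
  qed
  \<comment> \<open>Chosen so that \<open>\<delta>' powr (t - s) \<le> r / M\<close>: each
    \<open>t\<close>-th power is at most \<open>r / M\<close> times the \<open>s\<close>-th power,
    and the latter sum to less than \<open>M\<close>.\<close>
  define \<delta>' where "\<delta>' = min \<delta> ((r / M) powr (1 / (t - s)))"
  have "0 < \<delta>'" using \<open>0 < \<delta>\<close> r M by (simp add: \<delta>'_def)
  then have "hausdorff_premeasure s \<delta>' A \<le> hausdorff_measure s A"
    unfolding hausdorff_measure_def by (intro SUP_upper) simp
  then have "hausdorff_premeasure s \<delta>' A < ennreal M" using M(2) by (rule le_less_trans)
  then obtain C where C: "A \<subseteq> (\<Union>j. C j)" "\<And>j. bounded (C j) \<and> diameter (C j) \<le> \<delta>'"
    "(\<Sum>j. diam_power s (C j)) < ennreal M"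
    unfolding hausdorff_premeasure_def INF_less_iff by auto
  have le: "diam_power t (C j) \<le> ennreal (r / M) * diam_power s (C j)" for j
  proof (cases "C j = {}")
    case False
    have d: "0 \<le> diameter (C j)" "diameter (C j) \<le> \<delta>'" using C(2) by (auto intro: diameter_ge_0)
    then have "diameter (C j) powr (t - s) \<le> ((r / M) powr (1 / (t - s))) powr (t - s)"
      using st by (intro powr_mono2) (auto simp: \<delta>'_def)
    also have "\<dots> = r / M" using r M st by (simp add: powr_powr)
    finally have "diameter (C j) powr (t - s) * diameter (C j) powr s \<le> r / M * diameter (C j) powr s"
      by (intro mult_right_mono) auto
    then show ?thesis
      using False st r M by (simp add: diam_power_def powr_add[symmetric] ennreal_leI flip: ennreal_mult)
  qed (simp add: diam_power_def)
  have "(\<Sum>j. diam_power t (C j)) \<le> (\<Sum>j. ennreal (r / M) * diam_power s (C j))"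
    using le by (intro suminf_le) auto
  also have "\<dots> = ennreal (r / M) * (\<Sum>j. diam_power s (C j))" by simp
  also have "\<dots> \<le> ennreal (r / M) * ennreal M" using C(3) by (intro mult_left_mono) auto
  also have "\<dots> = e'" using M r by (simp flip: ennreal_mult)
  also note e'(2)
  finally show "\<exists>C. A \<subseteq> (\<Union>j. C j) \<and> (\<forall>j. bounded (C j) \<and> diameter (C j) \<le> \<delta>) \<and>
      (\<Sum>j. diam_power t (C j)) < e"
    using C(1,2) by (intro exI[of _ C]) (auto simp: \<delta>'_def)
qed

section \<open>Dimension bounds from null sets\<close>

lemma hausdorff_dim_le:
  assumes "0 \<le> d" "\<And>s. s > d \<Longrightarrow> hausdorff_measure s A = 0"
  shows "hausdorff_dim A \<le> ereal d"
proof (rule ereal_le_epsilon2)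
  fix e :: real assume "0 < e"
  then have "hausdorff_dim A \<le> ereal (d + e)"
    unfolding hausdorff_dim_def using assms by (intro INF_lower) auto
  then show "hausdorff_dim A \<le> ereal d + ereal e" by simp
qed

lemma hausdorff_dim_ge:
  assumes "hausdorff_measure d A \<noteq> 0" shows "ereal d \<le> hausdorff_dim A"
  unfolding hausdorff_dim_def
proof (rule INF_greatest)
  fix s assume "s \<in> {s. 0 \<le> s \<and> hausdorff_measure s A = 0}"
  then show "ereal d \<le> ereal s"
    using hausdorff_null_exponent_mono[of s A d] assms by (cases "s \<le> d") auto
qed

text \<open>A cover of the image pulls back to a cover of \<open>S\<close> whose diameters are at
  most \<open>K\<close> times the \<open>s\<close>-th powers of the original ones, so
  \<open>F\<close> cannot crush a set of positive length to an \<open>s\<close>-null set.\<close>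

lemma hausdorff_null_inverse_Hoelder:
  fixes F :: "'a::metric_space \<Rightarrow> 'b::metric_space"
  assumes F: "\<And>x y. x \<in> S \<Longrightarrow> y \<in> S \<Longrightarrow> dist x y \<le> K * dist (F x) (F y) powr s"
    and K: "0 < K" and s: "0 < s" and null: "hausdorff_measure s (F ` S) = 0"
  shows "hausdorff_measure 1 S = 0"
  unfolding hausdorff_null_iff
proof (intro allI impI)
  fix \<delta> :: real and e :: ennreal assume "0 < \<delta>" "0 < e"
  then obtain e' where e': "0 < e'" "e' < e" using dense by blast
  then obtain r where r: "e' = ennreal r" "0 < r"
    by (cases e') (auto simp: ennreal_less_zero_iff)
  define \<delta>' where "\<delta>' = (\<delta> / K) powr (1 / s)"
  have "0 < \<delta>'" "0 < ennreal (r / K)" using \<open>0 < \<delta>\<close> K r by (auto simp: \<delta>'_def)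
  then obtain C where C: "F ` S \<subseteq> (\<Union>j. C j)" "\<And>j. bounded (C j) \<and> diameter (C j) \<le> \<delta>'"
     "(\<Sum>j. diam_power s (C j)) < ennreal (r / K)"
    using null unfolding hausdorff_null_iff by metis
  define D where "D j = S \<inter> F -` C j" for j
  have dist: "\<And>x y j. x \<in> D j \<Longrightarrow> y \<in> D j \<Longrightarrow> dist x y \<le> K * diameter (C j) powr s"
  proof -
    fix x y j assume that: "x \<in> D j" "y \<in> D j"
    have "dist x y \<le> K * dist (F x) (F y) powr s" using that F by (auto simp: D_def)
    also have "\<dots> \<le> K * diameter (C j) powr s"
      using that C(2) K s
      by (intro mult_left_mono powr_mono2 diameter_bounded_bound) (auto simp: D_def)
    finally show "dist x y \<le> K * diameter (C j) powr s" .
  qed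
  have bdd: "bounded (D j)" for j
    using dist unfolding bounded_two_points by blast
  have diam: "diameter (D j) \<le> K * diameter (C j) powr s" for j
    using dist K by (intro diameter_le_dist) auto
  have "K * diameter (C j) powr s \<le> \<delta>" for j
  proof -
    have "diameter (C j) powr s \<le> \<delta>' powr s"
      using C(2) s by (intro powr_mono2) (auto intro: diameter_ge_0)
    also have "\<dots> = \<delta> / K" using \<open>0 < \<delta>\<close> K s by (simp add: \<delta>'_def powr_powr)
    finally show ?thesis using K by (simp add: field_simps)
  qed
  then have "bounded (D j) \<and> diameter (D j) \<le> \<delta>" for j
    using order_trans[OF diam] bdd by blast
  moreover have "S \<subseteq> (\<Union>j. D j)" using C(1) by (fastforce simp: D_def)
  moreover have "(\<Sum>j. diam_power 1 (D j)) < e"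
  proof -
    have "diam_power 1 (D j) \<le> ennreal K * diam_power s (C j)" for j
    proof (cases "D j = {}")
      case False
      moreover have "0 \<le> diameter (D j)"
        using bdd by (rule diameter_ge_0)
      moreover from False have "C j \<noteq> {}" by (auto simp: D_def)
      ultimately show ?thesis
        using diam[of j] s K by (simp add: diam_power_def flip: ennreal_mult)
    qed (simp add: diam_power_def)
    then have "(\<Sum>j. diam_power 1 (D j)) \<le> (\<Sum>j. ennreal K * diam_power s (C j))"
      by (intro suminf_le) auto
    also have "\<dots> = ennreal K * (\<Sum>j. diam_power s (C j))" by simp
    also have "\<dots> \<le> ennreal K * ennreal (r / K)" using C(3) by (intro mult_left_mono) auto
    also have "\<dots> = e'" using K r by (simp flip: ennreal_mult)
    finally show ?thesis using e' by simp
  qed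
  ultimately show "\<exists>C. S \<subseteq> (\<Union>j. C j) \<and> (\<forall>j. bounded (C j) \<and> diameter (C j) \<le> \<delta>) \<and>
      (\<Sum>j. diam_power 1 (C j)) < e" by blast
qed

text \<open>Needed because heights in \<open>koch_caps\<close> are relative to this measure of the
  base. Equal pieces give the upper bound; the lower bound is Lebesgue measure of an interval,
  carried over by the arc length parametrisation \<open>g\<close>.\<close>

lemma hausdorff_measure_1_segment:
  fixes a b :: "'a::euclidean_space"
  shows "hausdorff_measure 1 (closed_segment a b) = ennreal (dist a b)"
proof (rule antisym)
  have "hausdorff_premeasure 1 \<delta> (closed_segment a b) \<le> ennreal (dist a b)" if "\<delta> > 0" for \<delta>
  proof -
    obtain N :: nat where N: "N > 0" "dist a b / N \<le> \<delta>"
    proof -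
      obtain N where "dist a b / \<delta> < real N" using reals_Archimedean2 by blast
      moreover have "0 \<le> dist a b / \<delta>" using \<open>\<delta> > 0\<close> by simp
      ultimately show ?thesis using that[of N] \<open>\<delta> > 0\<close> by (cases "N = 0") (auto simp: field_simps)
    qed
    define q where "q j = a + (real j / N) *\<^sub>R (b - a)" for j
    define C where "C j = (if j < N then closed_segment (q j) (q (Suc j)) else {})" for j
    have d: "diameter (closed_segment (q j) (q (Suc j))) \<le> dist a b / N" for j
    proof -
      have "q (Suc j) - q j = (real (Suc j) / N - real j / N) *\<^sub>R (b - a)"
        by (simp only: q_def add_diff_cancel_left scaleR_left_diff_distrib)
      then have "norm (q (Suc j) - q j) = dist a b / N"
        by (simp add: dist_norm norm_minus_commute add_divide_distrib)
      then have "dist x y \<le> dist a b / N" if "x \<in> {q j, q (Suc j)}" "y \<in> {q j, q (Suc j)}" for x y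
        using that by (auto simp: dist_norm norm_minus_commute)
      then show ?thesis
        unfolding segment_convex_hull
        by (intro diameter_le_dist) (auto intro: convex_hull_dist_le[of "{q j, q (Suc j)}"])
    qed
    have "closed_segment a b \<subseteq> (\<Union>j. C j)"
    proof
      fix x assume "x \<in> closed_segment a b"
      then obtain u where u: "0 \<le> u" "u \<le> 1" "x = (1 - u) *\<^sub>R a + u *\<^sub>R b"
        by (auto simp: in_segment)
      then have x: "x = a + u *\<^sub>R (b - a)"
        by (simp add: scaleR_left_diff_distrib scaleR_right_diff_distrib)
      define j where "j = min (nat \<lfloor>u * N\<rfloor>) (N - 1)"
      have j: "j < N" "real j \<le> u * N" "u * N \<le> real j + 1"
        using subinterval_index[OF u(1,2) N(1)] by (simp_all add: j_def)
      define w where "w = u * N - j"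
      have "q (Suc j) = q j + (1 / N) *\<^sub>R (b - a)"
        by (simp add: q_def add_divide_distrib scaleR_left_distrib)
      then have "(1 - w) *\<^sub>R q j + w *\<^sub>R q (Suc j) = q j + (w / N) *\<^sub>R (b - a)"
        by (simp add: scaleR_left_diff_distrib scaleR_right_distrib)
      also have "\<dots> = a + (j / N + w / N) *\<^sub>R (b - a)" by (simp add: q_def scaleR_left_distrib)
      also have "j / N + w / N = u" using N by (simp add: w_def field_simps)
      finally have "x = (1 - w) *\<^sub>R q j + w *\<^sub>R q (Suc j)" using x by simp
      moreover have "0 \<le> w" "w \<le> 1" using j by (auto simp: w_def)
      ultimately have "x \<in> closed_segment (q j) (q (Suc j))" unfolding in_segment by blast
      then have "x \<in> C j" using j by (simp add: C_def)
      then show "x \<in> (\<Union>j. C j)" by blast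
    qed
    moreover have "bounded (C j) \<and> diameter (C j) \<le> \<delta>" for j
      using order_trans[OF d N(2), of j] that
      by (simp add: C_def compact_imp_bounded compact_segment)
    ultimately have "hausdorff_premeasure 1 \<delta> (closed_segment a b) \<le> (\<Sum>j. diam_power 1 (C j))"
      unfolding hausdorff_premeasure_def by (intro INF_lower) auto
    also have "\<dots> = (\<Sum>j<N. diam_power 1 (C j))"
      by (intro suminf_finite) (auto simp: C_def diam_power_def)
    also have "\<dots> \<le> (\<Sum>j<N. ennreal (dist a b / N))"
      using d by (intro sum_mono) (simp add: C_def diam_power_def compact_imp_bounded compact_segment
          diameter_ge_0 ennreal_leI)
    also have "\<dots> = ennreal (dist a b)"
      using N by (subst sum_ennreal) auto
    finally show ?thesis .
  qed
  then show "hausdorff_measure 1 (closed_segment a b) \<le> ennreal (dist a b)"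
    unfolding hausdorff_measure_def by (auto intro: SUP_least)
next
  define L where "L = dist a b"
  have "ennreal L \<le> hausdorff_premeasure 1 1 (closed_segment a b)"
    unfolding hausdorff_premeasure_def
  proof (rule INF_greatest)
    fix C :: "nat \<Rightarrow> 'a set"
    assume "C \<in> {C. closed_segment a b \<subseteq> (\<Union>j. C j) \<and> (\<forall>j. bounded (C j) \<and> diameter (C j) \<le> 1)}"
    then have C: "closed_segment a b \<subseteq> (\<Union>j. C j)" "\<And>j. bounded (C j)" by auto
    show "ennreal L \<le> (\<Sum>j. diam_power 1 (C j))"
    proof (cases "L = 0")
      case False
      then have L: "L > 0" by (simp add: L_def)
      define g where "g t = a + (t / L) *\<^sub>R (b - a)" for t
      have g: "dist (g t) (g t') = \<bar>t - t'\<bar>" for t t'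
      proof -
        have "g t - g t' = ((t - t') / L) *\<^sub>R (b - a)"
          by (simp add: g_def diff_divide_distrib scaleR_left_diff_distrib)
        then have "dist (g t) (g t') = \<bar>t - t'\<bar> / L * norm (b - a)" using L by (simp add: dist_norm)
        then show ?thesis using L by (simp add: L_def dist_norm norm_minus_commute)
      qed
      define J where "J j = {0..L} \<inter> g -` C j" for j
      \<comment> \<open>Covering sets need not be measurable, so each trace \<open>J j\<close> is
        enlarged to the interval between its extremes, which is Borel and no longer than the
        diameter of \<open>C j\<close>.\<close>
      define I where "I j = (if J j = {} then {} else {Inf (J j)..Sup (J j)})" for j
      have JI: "J j \<subseteq> I j" for j
      proof
        fix t assume t: "t \<in> J j"
        have "bdd_below (J j)" "bdd_above (J j)"
          unfolding J_def by (auto intro!: bdd_belowI[of _ 0] bdd_aboveI[of _ L])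
        then show "t \<in> I j" using t by (auto simp: I_def intro: cInf_lower cSup_upper)
      qed
      have "{0..L} \<subseteq> (\<Union>j. J j)"
      proof
        fix t assume t: "t \<in> {0..L}"
        have "g t = (1 - t / L) *\<^sub>R a + (t / L) *\<^sub>R b"
          by (simp add: g_def scaleR_left_diff_distrib scaleR_right_diff_distrib)
        moreover have "0 \<le> t / L" "t / L \<le> 1" using t L by auto
        ultimately have "g t \<in> closed_segment a b" unfolding in_segment by blast
        then show "t \<in> (\<Union>j. J j)" using C t by (auto simp: J_def)
      qed
      then have "{0..L} \<subseteq> (\<Union>j. I j)" using JI by blast
      then have "emeasure lborel {0..L} \<le> emeasure lborel (\<Union>j. I j)"
        by (intro emeasure_mono) (auto simp: I_def)
      also have "\<dots> \<le> (\<Sum>j. emeasure lborel (I j))"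
        by (intro emeasure_subadditive_countably) (auto simp: I_def)
      also have "\<dots> \<le> (\<Sum>j. diam_power 1 (C j))"
      proof (intro suminf_le allI)
        fix j
        show "emeasure lborel (I j) \<le> diam_power 1 (C j)"
        proof (cases "J j = {}")
          case False
          have "x - y \<le> diameter (C j)" if "x \<in> J j" "y \<in> J j" for x y
            using that diameter_bounded_bound[OF C(2), of "g x" j "g y"] g[of x y]
            by (auto simp: J_def)
          then have "Sup (J j) - diameter (C j) \<le> y" if "y \<in> J j" for y
            using that False cSup_least[of "J j" "y + diameter (C j)"] by (force simp: algebra_simps)
          then have le: "Sup (J j) - diameter (C j) \<le> Inf (J j)" using False by (intro cInf_greatest)
          obtain x where "x \<in> J j" using False by blast
          then have "x \<in> I j" using JI by blast
          then have "Inf (J j) \<le> Sup (J j)" using False by (simp add: I_def)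
          moreover have "C j \<noteq> {}" using False by (auto simp: J_def)
          moreover have "0 \<le> diameter (C j)" using C(2) by (rule diameter_ge_0)
          ultimately show ?thesis using False le
            by (simp add: I_def diam_power_def)
        qed (simp add: I_def)
      qed auto
      finally show ?thesis using L by simp
    qed simp
  qed
  also have "\<dots> \<le> hausdorff_measure 1 (closed_segment a b)"
    unfolding hausdorff_measure_def by (intro SUP_upper) simp
  finally show "ennreal (dist a b) \<le> hausdorff_measure 1 (closed_segment a b)" by (simp add: L_def)
qed

section \<open>Isosceles triangles in the plane\<close>

definition rot :: "real \<times> real \<Rightarrow> real \<times> real" where
  "rot z = (- snd z, fst z)"

text \<open>Apex of an isosceles triangle on the directed base from \<open>a\<close> to
  \<open>b\<close>, with signed height in units of the base length, positive on the left. In this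
  scale-free parameter the base angle and the ratio of edge to base do not depend on the
  base.\<close>

definition tip :: "real \<times> real \<Rightarrow> real \<times> real \<Rightarrow> real \<Rightarrow> real \<times> real" where
  "tip a b h = (1/2) *\<^sub>R (a + b) + h *\<^sub>R rot (b - a)"

lemma tip_swap: "tip b a (- h) = tip a b h"
  by (cases a; cases b) (simp add: tip_def rot_def field_simps)

lemma inner_rot [simp]: "rot x \<bullet> rot y = x \<bullet> y" "rot x \<bullet> x = 0" "x \<bullet> rot x = 0"
  by (simp_all add: rot_def inner_prod_def)

lemma norm_rot [simp]: "norm (rot x) = norm x"
  by (simp add: norm_eq_sqrt_inner)

lemma orthogonal_imp_rot:
  assumes "w \<bullet> d = 0" "d \<noteq> 0" shows "w = ((w \<bullet> rot d) / (d \<bullet> d)) *\<^sub>R rot d"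
proof -
  obtain x y where d: "d = (x, y)" by (cases d)
  obtain s t where w: "w = (s, t)" by (cases w)
  have ne: "x * x + y * y \<noteq> 0" using assms(2) by (auto simp: d sum_squares_eq_zero_iff zero_prod_def)
  have eq: "s * x = - (t * y)" using assms(1) by (simp add: d w)
  have "s * (x * x + y * y) = (t * x - s * y) * - y" "t * (x * x + y * y) = (t * x - s * y) * x"
    using eq by algebra+
  then show ?thesis using ne by (auto simp: d w rot_def field_simps)
qed

lemma dist_tip:
  "dist a (tip a b h) = dist a b * sqrt (1/4 + h\<^sup>2)" "dist (tip a b h) b = dist a b * sqrt (1/4 + h\<^sup>2)"
proof -
  have "(norm (tip a b h - a))\<^sup>2 = (norm (b - a))\<^sup>2 * (1/4 + h\<^sup>2)" for a b h
    unfolding power2_norm_eq_inner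
    by (cases a; cases b) (simp add: tip_def rot_def power2_eq_square field_simps)
  then have "norm (tip a b h - a) = sqrt ((norm (b - a))\<^sup>2 * (1/4 + h\<^sup>2))" for a b h
    by (metis norm_ge_zero real_sqrt_unique)
  then have *: "dist a (tip a b h) = dist a b * sqrt (1/4 + h\<^sup>2)" for a b h
    by (simp add: real_sqrt_mult dist_norm norm_minus_commute)
  then show "dist a (tip a b h) = dist a b * sqrt (1/4 + h\<^sup>2)" .
  show "dist (tip a b h) b = dist a b * sqrt (1/4 + h\<^sup>2)"
    using *[of b a "- h"] by (simp add: tip_swap dist_commute)
qed

lemma infdist_tip: "infdist (tip a b h) (affine hull {a, b}) = \<bar>h\<bar> * dist a b"
proof (rule antisym)
  have "(1/2) *\<^sub>R a + (1/2) *\<^sub>R b \<in> affine hull {a, b}"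
    unfolding affine_hull_2 by (rule CollectI) (intro exI[of _ "1/2::real"], simp)
  then have "infdist (tip a b h) (affine hull {a, b}) \<le> dist (tip a b h) ((1/2) *\<^sub>R a + (1/2) *\<^sub>R b)"
    by (rule infdist_le)
  also have "\<dots> = \<bar>h\<bar> * dist a b"
    by (simp add: tip_def dist_norm scaleR_add_right norm_minus_commute)
  finally show "infdist (tip a b h) (affine hull {a, b}) \<le> \<bar>h\<bar> * dist a b" .
next
  have "\<bar>h\<bar> * dist a b \<le> dist (tip a b h) y" if hull: "y \<in> affine hull {a, b}" for y
  proof -
    obtain u v where y: "y = u *\<^sub>R a + v *\<^sub>R b" "u + v = 1" using hull unfolding affine_hull_2 by blast
    have u: "u = 1 - v" using y(2) by simp
    have "tip a b h - y = (1/2 - v) *\<^sub>R (b - a) + h *\<^sub>R rot (b - a)"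
      by (cases a; cases b) (simp add: y(1) u tip_def rot_def field_simps)
    then have "(norm (tip a b h - y))\<^sup>2 = ((1/2 - v)\<^sup>2 + h\<^sup>2) * (norm (b - a))\<^sup>2"
      unfolding power2_norm_eq_inner
      by (cases a; cases b) (simp add: rot_def power2_eq_square field_simps)
    moreover have "h\<^sup>2 * (norm (b - a))\<^sup>2 \<le> ((1/2 - v)\<^sup>2 + h\<^sup>2) * (norm (b - a))\<^sup>2"
      by (intro mult_right_mono) auto
    ultimately have "(\<bar>h\<bar> * norm (b - a))\<^sup>2 \<le> (norm (tip a b h - y))\<^sup>2"
      by (simp add: power_mult_distrib)
    then have "\<bar>h\<bar> * norm (b - a) \<le> norm (tip a b h - y)" by (rule power2_le_imp_le) simp
    then show ?thesis by (simp add: dist_norm norm_minus_commute)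
  qed
  moreover have "affine hull {a, b} \<noteq> {}" by simp
  ultimately show "\<bar>h\<bar> * dist a b \<le> infdist (tip a b h) (affine hull {a, b})"
    unfolding infdist_def by (simp add: cINF_greatest del: affine_hull_eq_empty)
qed

lemma cap_height_tip: "cap_height a b (tip a b h) = \<bar>h\<bar> * dist a b"
  by (simp add: cap_height_def infdist_tip)

text \<open>Equidistance puts the apex on the perpendicular bisector of the base, whose points are
  exactly the \<open>tip a b h\<close>; noncollinearity excludes the midpoint
  \<open>h = 0\<close>.\<close>

lemma is_cap_apex_iff: "is_cap_apex a b v \<longleftrightarrow> a \<noteq> b \<and> (\<exists>h. h \<noteq> 0 \<and> v = tip a b h)"
proof
  assume "is_cap_apex a b v"
  then have nc: "\<not> collinear {a, b, v}" and eq: "dist a v = dist b v" by (auto simp: is_cap_apex_def)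
  have ab: "a \<noteq> b" using nc by auto
  define w where "w = v - (1/2) *\<^sub>R (a + b)"
  have "w \<bullet> (b - a) = 0"
  proof -
    have "(v - a) \<bullet> (v - a) = (v - b) \<bullet> (v - b)"
      using eq by (simp add: dist_norm norm_minus_commute[of _ v] norm_eq)
    then show ?thesis
      by (cases a; cases b; cases v) (simp add: w_def field_simps)
  qed
  then obtain h where "w = h *\<^sub>R rot (b - a)" using orthogonal_imp_rot[of w "b - a"] ab by auto
  then have v: "v = tip a b h" by (simp add: tip_def w_def algebra_simps)
  moreover have "h \<noteq> 0"
  proof
    assume "h = 0"
    then have "v = midpoint a b" using v by (simp add: tip_def midpoint_def)
    then have "collinear {a, v, b}" by (simp add: collinear_midpoint)
    then show False using nc by (simp add: insert_commute[of b v])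
  qed
  ultimately show "a \<noteq> b \<and> (\<exists>h. h \<noteq> 0 \<and> v = tip a b h)" using ab by blast
next
  assume "a \<noteq> b \<and> (\<exists>h. h \<noteq> 0 \<and> v = tip a b h)"
  then obtain h where ab: "a \<noteq> b" and h: "h \<noteq> 0" "v = tip a b h" by blast
  have "v \<notin> affine hull {a, b}"
  proof
    assume "v \<in> affine hull {a, b}"
    then have "infdist v (affine hull {a, b}) = 0" by simp
    then show False using ab h by (simp add: infdist_tip)
  qed
  then have "\<not> collinear {a, b, v}" using ab by (simp add: collinear_3_affine_hull)
  moreover have "dist a v = dist b v" using dist_tip[of a b h] by (simp add: h dist_commute)
  ultimately show "is_cap_apex a b v" by (simp add: is_cap_apex_def)
qed

lemma cap_base_angle_tip:
  assumes "a \<noteq> b" shows "cap_base_angle a b (tip a b h) = arctan (2 * \<bar>h\<bar>)"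
proof -
  have "(b - a) \<bullet> (tip a b h - a) = (norm (b - a))\<^sup>2 / 2"
    unfolding power2_norm_eq_inner
    by (cases a; cases b) (simp add: tip_def rot_def field_simps)
  moreover have "norm (tip a b h - a) = norm (b - a) * sqrt (1/4 + h\<^sup>2)"
    using dist_tip(1)[of a b h] by (simp add: dist_norm norm_minus_commute)
  ultimately have "cap_base_angle a b (tip a b h) =
      arccos ((norm (b - a))\<^sup>2 / 2 / (norm (b - a) * (norm (b - a) * sqrt (1/4 + h\<^sup>2))))"
    by (simp only: cap_base_angle_def)
  also have "(norm (b - a))\<^sup>2 / 2 / (norm (b - a) * (norm (b - a) * sqrt (1/4 + h\<^sup>2))) =
      1 / (2 * sqrt (1/4 + h\<^sup>2))"
    using assms by (simp add: power2_eq_square field_simps)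
  also have "2 * sqrt (1/4 + h\<^sup>2) = sqrt (1 + (2 * \<bar>h\<bar>)\<^sup>2)"
    using real_sqrt_mult[of 4 "1/4 + h\<^sup>2"] by (simp add: power_mult_distrib)
  also have "1 / \<dots> = cos (arctan (2 * \<bar>h\<bar>))" by (simp add: cos_arctan)
  also have "arccos \<dots> = arctan (2 * \<bar>h\<bar>)"
  proof (rule arccos_cos)
    show "arctan (2 * \<bar>h\<bar>) \<le> pi"
      using arctan_ubound[of "2 * \<bar>h\<bar>"] pi_gt_zero by linarith
  qed simp
  finally show ?thesis .
qed

section \<open>Position of the caps on the two edges of a cap\<close>

lemma convex_hull_inner_le:
  assumes "\<And>x. x \<in> S \<Longrightarrow> u \<bullet> x \<le> c" "P \<in> convex hull S" shows "u \<bullet> P \<le> c"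
proof -
  have "convex hull S \<subseteq> {x. u \<bullet> x \<le> c}"
    using assms(1) by (intro hull_minimal) (auto simp: convex_halfspace_le)
  then show ?thesis using assms(2) by auto
qed

text \<open>Projected to the direction of the base, \<open>tip a b h\<close> sits exactly half a
  base away from \<open>b\<close>, and the other two vertices of the child lie further back because
  \<open>h * h'\<close> is tiny. Cauchy-Schwarz turns the projection into a distance.\<close>

lemma tip_child_far:
  assumes h: "\<bar>h\<bar> \<le> 1/100" "\<bar>h'\<bar> \<le> 1/100"
    and P: "P \<in> convex hull {a, tip a b h, tip a (tip a b h) h'}"
  shows "dist a b \<le> 2 * dist P b"
proof (cases "a = b")
  case False
  define d where "d = b - a"
  have "\<bar>h\<bar> * \<bar>h'\<bar> \<le> (1/100) * (1/100)" using h by (intro mult_mono) auto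
  then have hh: "\<bar>h * h'\<bar> \<le> 1/10000" by (simp add: abs_mult)
  have v: "d \<bullet> tip a b h = d \<bullet> b - (1/2) * (d \<bullet> d)"
    by (cases a; cases b) (simp add: d_def tip_def rot_def field_simps)
  have v': "d \<bullet> tip a (tip a b h) h' = d \<bullet> b - (3/4 + h * h') * (d \<bullet> d)"
    by (cases a; cases b) (simp add: d_def tip_def rot_def field_simps)
  have "(1/2) * (d \<bullet> d) \<le> (3/4 + h * h') * (d \<bullet> d)" using hh by (intro mult_right_mono) auto
  moreover have "d \<bullet> a = d \<bullet> b - d \<bullet> d" by (simp add: d_def inner_diff_right)
  ultimately have "d \<bullet> P \<le> d \<bullet> b - (1/2) * (d \<bullet> d)"
    using v v' by (intro convex_hull_inner_le[OF _ P]) auto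
  then have "(1/2) * (d \<bullet> d) \<le> d \<bullet> (b - P)" by (simp add: inner_diff_right)
  also have "\<dots> \<le> norm d * norm (b - P)" by (rule norm_cauchy_schwarz)
  finally have "norm d * norm d \<le> norm d * (2 * norm (b - P))"
    by (simp add: power2_norm_eq_inner[symmetric] power2_eq_square)
  then have "norm d \<le> 2 * norm (b - P)" using False by (simp add: d_def)
  then show ?thesis by (simp add: d_def dist_norm norm_minus_commute)
qed simp

text \<open>The inner product is affine in \<open>P\<close> and in \<open>Q\<close> separately, so
  the vertices decide. Pairs involving \<open>v\<close> give zero; the other four are multiples of
  the squared base length \<open>D\<close>, with negative main terms and corrections of order
  1/10000.\<close>

lemma tip_siblings_obtuse:
  assumes h: "\<bar>h\<bar> \<le> 1/100" "\<bar>h1\<bar> \<le> 1/100" "\<bar>h2\<bar> \<le> 1/100" and v: "v = tip a b h"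
    and P: "P \<in> convex hull {a, v, tip a v h1}" and Q: "Q \<in> convex hull {v, b, tip v b h2}"
  shows "(P - v) \<bullet> (Q - v) \<le> 0"
proof -
  define D where "D = (b - a) \<bullet> (b - a)"
  have D: "0 \<le> D" by (simp add: D_def)
  have hh: "\<bar>x * y\<bar> \<le> 1/10000" if "\<bar>x\<bar> \<le> 1/100" "\<bar>y\<bar> \<le> 1/100" for x y :: real
    using mult_mono[OF that] by (simp add: abs_mult)
  note hs = hh[OF h(1) h(1)] hh[OF h(1) h(2)] hh[OF h(1) h(3)] hh[OF h(2) h(3)]
  have 1: "(a - v) \<bullet> (b - v) = (h * h - 1/4) * D"
    by (cases a; cases b) (simp add: D_def v tip_def rot_def field_simps)
  have 2: "(a - v) \<bullet> (tip v b h2 - v) = ((h * h - 1/4) / 2 - h * h2) * D"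
    by (cases a; cases b) (simp add: D_def v tip_def rot_def field_simps)
  have 3: "(tip a v h1 - v) \<bullet> (b - v) = ((h * h - 1/4) / 2 - h * h1) * D"
    by (cases a; cases b) (simp add: D_def v tip_def rot_def field_simps)
  have 4: "(tip a v h1 - v) \<bullet> (tip v b h2 - v) =
      ((1/4 - h1 * h2) * (h * h - 1/4) - h * h1 / 2 - h * h2 / 2) * D"
    by (cases a; cases b) (simp add: D_def v tip_def rot_def field_simps)
  \<comment> \<open>Bounding both factors crudely by 1/8 leaves -1/64 as the negative contribution,
    far more than the remaining mixed terms, which amount to at most 1/10000.\<close>
  have "(1/4 - h1 * h2) * (1/4 - h * h) \<ge> (1/8) * (1/8)"
    using hs by (intro mult_mono) auto
  then have "(1/4 - h1 * h2) * (h * h - 1/4) \<le> - 1/64"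
    by (simp add: algebra_simps)
  then have le: "(1/4 - h1 * h2) * (h * h - 1/4) - h * h1 / 2 - h * h2 / 2 \<le> 0"
    "h * h - 1/4 \<le> 0" "(h * h - 1/4) / 2 - h * h2 \<le> 0" "(h * h - 1/4) / 2 - h * h1 \<le> 0"
    using hs by auto
  have xy: "(x - v) \<bullet> (y - v) \<le> 0" if "x \<in> {a, v, tip a v h1}" "y \<in> {v, b, tip v b h2}" for x y
    using that 1 2 3 4 le[THEN mult_nonpos_nonneg, OF D] by auto
  have "(y - v) \<bullet> P \<le> (y - v) \<bullet> v" if y: "y \<in> {v, b, tip v b h2}" for y
  proof (rule convex_hull_inner_le[OF _ P])
    fix x assume "x \<in> {a, v, tip a v h1}"
    then have "(y - v) \<bullet> (x - v) \<le> 0" using xy[OF _ y] by (simp only: inner_commute[of "y - v"])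
    then show "(y - v) \<bullet> x \<le> (y - v) \<bullet> v" by (simp only: inner_diff_right diff_le_0_iff_le)
  qed
  then have "(P - v) \<bullet> y \<le> (P - v) \<bullet> v" if y: "y \<in> {v, b, tip v b h2}" for y
  proof -
    have "(y - v) \<bullet> (P - v) \<le> 0"
      using \<open>\<And>y. y \<in> {v, b, tip v b h2} \<Longrightarrow> (y - v) \<bullet> P \<le> (y - v) \<bullet> v\<close>[OF y]
      by (simp only: inner_diff_right diff_le_0_iff_le)
    then have "(P - v) \<bullet> (y - v) \<le> 0" by (simp only: inner_commute)
    then show ?thesis by (simp only: inner_diff_right diff_le_0_iff_le)
  qed
  then have "(P - v) \<bullet> Q \<le> (P - v) \<bullet> v" by (rule convex_hull_inner_le[OF _ Q])
  then show ?thesis by (simp add: inner_diff_right)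
qed

text \<open>Law of cosines: with a nonpositive inner product at \<open>v\<close>, the side opposite
  \<open>v\<close> is the longest.\<close>

lemma dist_ge_of_obtuse:
  fixes P Q v :: "'a::real_inner"
  assumes "(P - v) \<bullet> (Q - v) \<le> 0"
  shows "dist P v \<le> dist P Q" "dist Q v \<le> dist P Q"
proof -
  have "(norm (P - Q))\<^sup>2 = (norm (P - v))\<^sup>2 + (norm (Q - v))\<^sup>2 - 2 * ((P - v) \<bullet> (Q - v))"
    using power2_norm_eq_inner[of "(P - v) - (Q - v)"]
    by (simp add: power2_norm_eq_inner inner_diff_left inner_diff_right inner_commute)
  then have "(norm (P - v))\<^sup>2 \<le> (norm (P - Q))\<^sup>2" "(norm (Q - v))\<^sup>2 \<le> (norm (P - Q))\<^sup>2"
    using assms by (smt (verit) zero_le_power2)+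
  then show "dist P v \<le> dist P Q" "dist Q v \<le> dist P Q"
    by (auto simp: dist_norm intro: power2_le_imp_le)
qed

text \<open>The line through an edge has the whole cap on one side, expressed by the functional
  \<open>u\<close>; a child's apex with a height of the same sign would lie strictly on the other
  side. The second claim is the first with the base reversed, which negates both heights.\<close>

lemma tip_child_inside_sign:
  assumes "a \<noteq> b"
  shows "tip a (tip a b h) h' \<in> convex hull {a, b, tip a b h} \<Longrightarrow> h * h' \<le> 0"
    and "tip (tip a b h) b h' \<in> convex hull {a, b, tip a b h} \<Longrightarrow> h * h' \<le> 0"
proof -
  have *: "h * h' \<le> 0" if "a \<noteq> b" and P: "tip a (tip a b h) h' \<in> convex hull {a, b, tip a b h}" for a b h h'
  proof -
    define v where "v = tip a b h"
    define D where "D = (b - a) \<bullet> (b - a)"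
    define u where "u = h *\<^sub>R rot (v - a)"
    have D: "0 < D" using that by (simp add: D_def)
    have b: "u \<bullet> b = u \<bullet> a - h * h * D" and v: "u \<bullet> v = u \<bullet> a"
      by (cases a; cases b; simp add: u_def D_def v_def tip_def rot_def field_simps)+
    have t: "u \<bullet> tip a v h' = u \<bullet> a + (h * h') * ((1/4 + h * h) * D)"
      by (cases a; cases b) (simp add: u_def D_def v_def tip_def rot_def field_simps)
    have "u \<bullet> tip a v h' \<le> u \<bullet> a"
      by (rule convex_hull_inner_le[of "{a, b, v}"]) (use P b v D in \<open>auto simp: v_def\<close>)
    then have "(h * h') * ((1/4 + h * h) * D) \<le> 0" using t by simp
    moreover have "0 < (1/4 + h * h) * D" using D by (intro mult_pos_pos) (auto intro: add_pos_nonneg)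
    ultimately show ?thesis using mult_pos_pos[of "h * h'"] by (meson not_le)
  qed
  show "tip a (tip a b h) h' \<in> convex hull {a, b, tip a b h} \<Longrightarrow> h * h' \<le> 0"
    using * assms by blast
  show "tip (tip a b h) b h' \<in> convex hull {a, b, tip a b h} \<Longrightarrow> h * h' \<le> 0"
    using *[of b a "- h" "- h'"] assms by (simp add: tip_swap insert_commute)
qed

text \<open>With height \<open>- h\<close> the child's apex lands on the base of the parent itself,
  dividing it in the proportion given by \<open>1/4 + h * h\<close>.\<close>

lemma tip_child_opposite:
  assumes "\<bar>h\<bar> \<le> 1/100"
  shows "tip a (tip a b h) (- h) \<in> convex hull {a, b, tip a b h}"
    and "tip (tip a b h) b (- h) \<in> convex hull {a, b, tip a b h}"
proof -
  have *: "tip a (tip a b h) (- h) \<in> convex hull {a, b, tip a b h}" if "\<bar>h\<bar> \<le> 1/100" for a b h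
  proof -
    have "\<bar>h\<bar> * \<bar>h\<bar> \<le> (1/100) * (1/100)" using that by (intro mult_mono) auto
    then have "1/4 + h * h \<le> 1" by simp
    moreover have "tip a (tip a b h) (- h) = (1 - (1/4 + h * h)) *\<^sub>R a + (1/4 + h * h) *\<^sub>R b"
      by (cases a; cases b) (simp add: tip_def rot_def field_simps)
    ultimately have "tip a (tip a b h) (- h) \<in> closed_segment a b"
      unfolding in_segment by (intro exI[of _ "1/4 + h * h"]) auto
    then show ?thesis unfolding segment_convex_hull using hull_mono[of "{a, b}" "{a, b, tip a b h}"] by blast
  qed
  show "tip a (tip a b h) (- h) \<in> convex hull {a, b, tip a b h}" using * assms by blast
  show "tip (tip a b h) b (- h) \<in> convex hull {a, b, tip a b h}"
    using *[of "- h" b a] assms tip_swap[of a b h, symmetric] tip_swap[of "tip a b h" b h]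
    by (simp add: tip_swap insert_commute)
qed

section \<open>Lengths and angles along the caps\<close>

definition ratio :: "real \<Rightarrow> real" where
  "ratio \<gamma> = 1/2 * sqrt (1 + (tan \<gamma>)\<^sup>2)"

text \<open>Below \<open>pi / 4\<close> the tangent is less than one. The resulting range makes
  \<open>ln (ratio \<gamma>)\<close> negative, so the quotient in \<open>koch_f1\<close> has a
  nonzero denominator.\<close>

lemma ratio_bounds:
  assumes "0 \<le> \<gamma>" "\<gamma> < pi / 4" shows "1/2 \<le> ratio \<gamma>" "ratio \<gamma> < 1"
proof -
  have "0 \<le> tan \<gamma>" "tan \<gamma> < 1"
    using assms tan_monotone[of \<gamma> "pi / 4"] tan_45 pi_gt_zero by (auto intro: tan_pos_pi2_le)
  then have "(tan \<gamma>)\<^sup>2 < 1" by (simp add: power_less_one_iff)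
  then have "sqrt (1 + (tan \<gamma>)\<^sup>2) < 2" by (intro real_less_lsqrt) auto
  then show "ratio \<gamma> < 1" by (simp add: ratio_def)
  show "1/2 \<le> ratio \<gamma>" by (simp add: ratio_def)
qed

lemma ratio_mono:
  assumes "0 \<le> \<alpha>" "\<alpha> \<le> \<beta>" "\<beta> < pi / 2" shows "ratio \<alpha> \<le> ratio \<beta>"
proof -
  have "0 \<le> tan \<alpha>" "tan \<alpha> \<le> tan \<beta>"
    using assms tan_mono_le[of \<alpha> \<beta>] by (auto intro: tan_pos_pi2_le)
  then show ?thesis by (simp add: ratio_def power_mono)
qed

lemma koch_f1_eq: "koch_f1 \<gamma> = - (ln 2 / ln (ratio \<gamma>))"
  by (simp add: koch_f1_def ratio_def)

lemma koch_f1_ge_1: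
  assumes "0 \<le> \<gamma>" "\<gamma> < pi / 4" shows "1 \<le> koch_f1 \<gamma>"
proof -
  have "ln (ratio \<gamma>) < 0" "ln (1/2) \<le> ln (ratio \<gamma>)"
    using ratio_bounds[OF assms] by (auto simp: ln_less_zero ln_le_cancel_iff simp del: ln_div)
  then show ?thesis by (simp add: koch_f1_eq ln_div field_simps)
qed

lemma ratio_powr_koch_f1:
  assumes "0 \<le> \<gamma>" "\<gamma> < pi / 4" shows "ratio \<gamma> powr koch_f1 \<gamma> = 1/2"
proof -
  have "ln (ratio \<gamma>) < 0" "0 < ratio \<gamma>"
    using ratio_bounds[OF assms] by (auto simp: ln_less_zero)
  then have "ratio \<gamma> powr koch_f1 \<gamma> = exp (- ln 2)"
    by (simp add: powr_def koch_f1_eq)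
  then show ?thesis by (simp add: exp_minus)
qed

lemma continuous_on_koch_f1: "continuous_on {0..<pi/4} koch_f1"
proof -
  have "cos \<gamma> \<noteq> 0" if "\<gamma> \<in> {0..<pi/4}" for \<gamma>
    using that cos_gt_zero_pi[of \<gamma>] by auto
  moreover have "ln (ratio \<gamma>) \<noteq> 0" "ratio \<gamma> \<noteq> 0" if "\<gamma> \<in> {0..<pi/4}" for \<gamma>
    using ratio_bounds[of \<gamma>] that by auto
  ultimately show ?thesis
    unfolding koch_f1_eq[abs_def] ratio_def[abs_def]
    by (intro continuous_intros) auto
qed

text \<open>Caps are numbered from \<open>0\<close> here: \<open>cap p n (Suc k)\<close> has the base from \<open>p n k\<close> to
  \<open>p n (Suc k)\<close>, and its children are \<open>cap p (Suc n) (Suc (2 * k))\<close> and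
  \<open>cap p (Suc n) (Suc (Suc (2 * k)))\<close>.\<close>

locale cap_system =
  fixes p :: "nat \<Rightarrow> nat \<Rightarrow> real \<times> real"
  assumes nested: "nested_caps p"
begin

text \<open>The absolute value carries the base angle, the sign tells the side of the directed base
  on which the apex lies.\<close>

definition height :: "nat \<Rightarrow> nat \<Rightarrow> real" where
  "height n k = (SOME h. h \<noteq> 0 \<and> p (Suc n) (Suc (2 * k)) = tip (p n k) (p n (Suc k)) h)"

definition len :: "nat \<Rightarrow> nat \<Rightarrow> real" where
  "len n k = dist (p n k) (p n (Suc k))"

lemma even_vertex: "k \<le> 2^n \<Longrightarrow> p (Suc n) (2 * k) = p n k"
  using nested by (simp add: nested_caps_def)

lemma is_cap_apex:
  assumes "k < 2^n" shows "is_cap_apex (p n k) (p n (Suc k)) (p (Suc n) (Suc (2 * k)))"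
proof -
  have "is_cap_apex (p n (Suc k - 1)) (p n (Suc k)) (apex p n (Suc k))"
    using nested assms unfolding nested_caps_def by (metis Suc_leI atLeastAtMost_iff le_add1 plus_1_eq_Suc)
  then show ?thesis by (simp add: apex_def)
qed

lemma distinct_vertices: "k < 2^n \<Longrightarrow> p n k \<noteq> p n (Suc k)"
  using is_cap_apex is_cap_apex_iff by blast

lemma height:
  assumes "k < 2^n"
  shows "height n k \<noteq> 0" "p (Suc n) (Suc (2 * k)) = tip (p n k) (p n (Suc k)) (height n k)"
proof -
  have "\<exists>h. h \<noteq> 0 \<and> p (Suc n) (Suc (2 * k)) = tip (p n k) (p n (Suc k)) h"
    using is_cap_apex[OF assms] is_cap_apex_iff by blast
  from someI_ex[OF this]
  show "height n k \<noteq> 0" "p (Suc n) (Suc (2 * k)) = tip (p n k) (p n (Suc k)) (height n k)"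
    by (simp_all add: height_def)
qed

lemma cap_eq: "cap p n (Suc k) = convex hull {p n k, p n (Suc k), p (Suc n) (Suc (2 * k))}"
  by (simp add: cap_def apex_def)

lemma base_angle_eq: "k < 2^n \<Longrightarrow> base_angle p n (Suc k) = arctan (2 * \<bar>height n k\<bar>)"
  using height[of k n] distinct_vertices[of k n]
  by (simp add: base_angle_def apex_def cap_base_angle_tip)

lemma base_angle_bounds:
  "k < 2^n \<Longrightarrow> 0 < base_angle p n (Suc k)" "k < 2^n \<Longrightarrow> base_angle p n (Suc k) < pi / 2"
  using arctan_ubound by (simp_all only: base_angle_eq zero_less_arctan_iff) (simp add: height)

lemma cap_child:
  assumes "k < 2^Suc n" shows "cap p (Suc n) (Suc k) \<subseteq> cap p n (Suc (k div 2))"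
proof -
  have "Suc (k div 2) \<in> {1..2^n}" using assms by (auto simp: Suc_le_eq)
  moreover have "Suc k \<in> {2 * Suc (k div 2) - 1, 2 * Suc (k div 2)}" by auto
  ultimately show ?thesis using nested unfolding nested_caps_def by blast
qed

lemma cap_eq_even: "k < 2^n \<Longrightarrow> cap p (Suc n) (Suc (2 * k)) =
    convex hull {p n k, p (Suc n) (Suc (2 * k)),
      tip (p n k) (p (Suc n) (Suc (2 * k))) (height (Suc n) (2 * k))}"
  using height[of "2 * k" "Suc n"] by (simp add: cap_eq even_vertex)

lemma cap_eq_odd: "k < 2^n \<Longrightarrow> cap p (Suc n) (Suc (Suc (2 * k))) =
    convex hull {p (Suc n) (Suc (2 * k)), p n (Suc k),
      tip (p (Suc n) (Suc (2 * k))) (p n (Suc k)) (height (Suc n) (Suc (2 * k)))}"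
  using height[of "Suc (2 * k)" "Suc n"] even_vertex[of "Suc k" n] by (simp add: cap_eq)

lemma vertex_refine: "k \<le> 2^n \<Longrightarrow> p (n + m) (k * 2^m) = p n k"
proof (induction m)
  case (Suc m)
  have "k * 2^m \<le> 2^(n + m)" using Suc.prems by (simp add: power_add)
  from even_vertex[OF this] show ?case using Suc by (simp add: mult.left_commute)
qed simp

lemma segment_subset_cap: "closed_segment (p n k) (p n (Suc k)) \<subseteq> cap p n (Suc k)"
  unfolding cap_eq segment_convex_hull by (intro hull_mono) auto

lemma closed_cap: "closed (cap p n (Suc k))"
  unfolding cap_eq by (intro compact_imp_closed finite_imp_compact_convex_hull) auto

lemma len_pos: "k < 2^n \<Longrightarrow> 0 < len n k"
  using distinct_vertices by (simp add: len_def)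

lemma sqrt_height:
  assumes "k < 2^n" shows "sqrt (1/4 + (height n k)\<^sup>2) = ratio (base_angle p n (Suc k))"
proof -
  have "2 * sqrt (1/4 + (height n k)\<^sup>2) = sqrt (1 + (2 * \<bar>height n k\<bar>)\<^sup>2)"
    using real_sqrt_mult[of 4 "1/4 + (height n k)\<^sup>2"] by (simp add: power_mult_distrib)
  then show ?thesis by (simp add: ratio_def base_angle_eq[OF assms] tan_arctan)
qed

lemma len_child:
  assumes "k < 2^Suc n"
  shows "len (Suc n) k = len n (k div 2) * ratio (base_angle p n (Suc (k div 2)))"
proof -
  have k: "k div 2 < 2^n" using assms by auto
  note [simp] = sqrt_height[OF k] height(2)[OF k]
  have even_vertex1: "p (Suc n) (2 * (k div 2)) = p n (k div 2)"
    "p (Suc n) (Suc (Suc (2 * (k div 2)))) = p n (Suc (k div 2))"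
    using even_vertex[of "k div 2" n] even_vertex[of "Suc (k div 2)" n] k by auto
  consider "k = 2 * (k div 2)" | "k = Suc (2 * (k div 2))" by linarith
  then show ?thesis
  proof cases
    case 1
    then have "len (Suc n) k = dist (p n (k div 2)) (p (Suc n) (Suc (2 * (k div 2))))"
      unfolding len_def even_vertex1(1)[symmetric] by simp
    then show ?thesis by (simp add: dist_tip len_def)
  next
    case 2
    then have "len (Suc n) k = dist (p (Suc n) (Suc (2 * (k div 2)))) (p n (Suc (k div 2)))"
      unfolding len_def even_vertex1(2)[symmetric] by simp
    then show ?thesis by (simp add: dist_tip len_def)
  qed
qed

end

text \<open>Kept apart from \<open>cap_system\<close> because uniqueness of the constant-angle caps
  is shown for an arbitrary family satisfying \<open>const_caps\<close>, from its nesting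
  alone.\<close>

locale koch_system =
  fixes p :: "nat \<Rightarrow> nat \<Rightarrow> real \<times> real"
  assumes koch: "koch_caps p"

sublocale koch_system \<subseteq> cap_system
  using koch by unfold_locales (simp add: koch_caps_def)

context koch_system
begin

definition point :: "real \<Rightarrow> real \<times> real" where
  "point t = p 0 0 + t *\<^sub>R (p 0 1 - p 0 0)"

lemma height_0: "\<bar>height 0 0\<bar> < 1/100"
proof -
  obtain \<epsilon> :: real where \<epsilon>: "0 < \<epsilon>" "\<epsilon> < 1/100"
    "ennreal (cap_height (p 0 0) (p 0 1) (apex p 0 1)) = ennreal \<epsilon> * hausdorff_measure 1 (base p 0 1)"
    using koch unfolding koch_caps_def by blast
  have "apex p 0 1 = tip (p 0 0) (p 0 1) (height 0 0)"
    using height(2)[of 0 0] by (simp add: apex_def)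
  then have "ennreal (\<bar>height 0 0\<bar> * len 0 0) = ennreal (\<epsilon> * len 0 0)"
    using \<epsilon> by (simp add: cap_height_tip base_def hausdorff_measure_1_segment len_def ennreal_mult)
  moreover have "0 < len 0 0" using len_pos by simp
  ultimately have "\<bar>height 0 0\<bar> = \<epsilon>" using \<epsilon>(1) by (simp add: ennreal_inj)
  then show ?thesis using \<epsilon> by simp
qed

lemma base_angle_child:
  assumes "k < 2^Suc n" shows "base_angle p (Suc n) (Suc k) \<le> base_angle p n (Suc (k div 2))"
proof -
  have "Suc (k div 2) \<in> {1..2^n}" using assms by (auto simp: Suc_le_eq)
  moreover have "Suc k \<in> {2 * Suc (k div 2) - 1, 2 * Suc (k div 2)}" by auto
  ultimately show ?thesis using koch unfolding koch_caps_def by blast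
qed

text \<open>Base angles do not increase from parent to child and equal the arctangent of twice the
  absolute height, so the bound at the root is inherited by every cap.\<close>

lemma height_le: "k < 2^n \<Longrightarrow> \<bar>height n k\<bar> \<le> 1/100"
proof (induction n arbitrary: k)
  case 0
  then show ?case using height_0 by simp
next
  case (Suc n)
  have "k div 2 < 2^n" using Suc.prems by auto
  then show ?case
    using Suc.IH[of "k div 2"] base_angle_child[OF Suc.prems] base_angle_eq[OF Suc.prems]
      base_angle_eq[of "k div 2" n] by (simp add: arctan_le_iff)
qed

lemma base_angle_small: "k < 2^n \<Longrightarrow> base_angle p n (Suc k) < pi / 4"
  using height_le[of k n] arctan_less_iff[of "2 * \<bar>height n k\<bar>" 1]
  by (simp add: base_angle_eq arctan_one)

text \<open>A crude contraction factor that drives convergence: \<open>1/4 + 1/10000\<close> is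
  below \<open>9/16\<close>. The dimension estimates use the sharp rate \<open>ratio\<close>
  instead.\<close>

lemma sqrt_height_le: "k < 2^n \<Longrightarrow> sqrt (1/4 + (height n k)\<^sup>2) \<le> 3/4"
  using power_mono[OF height_le[of k n], of 2]
  by (intro real_le_lsqrt) (auto simp: power2_eq_square)

lemma ratio_le: "k < 2^n \<Longrightarrow> ratio (base_angle p n (Suc k)) \<le> 3/4"
  using sqrt_height_le sqrt_height by simp

text \<open>The diameter of a triangle is its longest side, here the base, since the other two edges
  are at most 3/4 of it.\<close>

lemma cap_dist_le:
  assumes "k < 2^n" "x \<in> cap p n (Suc k)" "y \<in> cap p n (Suc k)"
  shows "dist x y \<le> len n k"
proof -
  have s: "len n k * sqrt (1/4 + (height n k)\<^sup>2) \<le> len n k * 1"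
    using order_trans[OF sqrt_height_le[OF assms(1)], of 1] len_pos[OF assms(1)]
    by (intro mult_left_mono) (simp_all del: real_sqrt_le_1_iff)
  note d = dist_tip[of "p n k" "p n (Suc k)" "height n k", folded len_def height(2)[OF assms(1)]]
  show ?thesis
    using assms(2,3) unfolding cap_eq
    by (rule convex_hull_dist_le[rotated])
      (use s d len_pos[OF assms(1)] in \<open>auto simp: dist_commute len_def\<close>)
qed

lemma len_le: "k < 2^n \<Longrightarrow> len n k \<le> len 0 0 * (3/4)^n"
proof (induction n arbitrary: k)
  case (Suc n)
  have k: "k div 2 < 2^n" using Suc.prems by auto
  have "len (Suc n) k \<le> len n (k div 2) * (3/4)"
    unfolding len_child[OF Suc.prems] using ratio_le[OF k] len_pos[OF k] by simp
  then show ?case using Suc.IH[OF k] by simp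
qed simp

lemma len_tendsto_0: "(\<lambda>n. len 0 0 * (3/4)^n) \<longlonglongrightarrow> 0"
  using tendsto_mult_right_zero[OF LIMSEQ_power_zero[of "3/4::real"]] by simp

text \<open>Angles do not increase downwards, so an angle bound at one cap controls the shrinking
  factor at all its descendants.\<close>

lemma len_descendant:
  assumes k: "k < 2^(n + m)" and \<gamma>: "\<gamma> < pi / 4" "base_angle p n (Suc (k div 2^m)) \<le> \<gamma>"
  shows "base_angle p (n + m) (Suc k) \<le> \<gamma>" "len (n + m) k \<le> len n (k div 2^m) * ratio \<gamma> ^ m"
proof -
  have "base_angle p (n + m) (Suc k) \<le> \<gamma> \<and> len (n + m) k \<le> len n (k div 2^m) * ratio \<gamma> ^ m"
    using k \<gamma>(2)
  proof (induction m arbitrary: k)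
    case (Suc m)
    have k: "k < 2^Suc (n + m)" and k2: "k div 2 < 2^(n + m)" using Suc.prems by auto
    have "base_angle p n (Suc (k div 2 div 2^m)) \<le> \<gamma>"
      using Suc.prems by (simp add: div_mult2_eq)
    note IH = Suc.IH[OF k2 this]
    have le: "ratio (base_angle p (n + m) (Suc (k div 2))) \<le> ratio \<gamma>"
      using IH base_angle_bounds(1)[OF k2] \<gamma>(1) by (intro ratio_mono) auto
    have "0 < \<gamma>" using IH base_angle_bounds(1)[OF k2] by linarith
    then have "0 \<le> ratio \<gamma>" using ratio_bounds(1)[of \<gamma>] \<gamma>(1) by simp
    then have "len (Suc (n + m)) k \<le> len n (k div 2 div 2^m) * ratio \<gamma> ^ m * ratio \<gamma>"
      unfolding len_child[OF k] using IH le len_pos[OF k2]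
      by (intro mult_mono) (auto simp: ratio_def)
    then show ?case using base_angle_child[OF k] IH by (simp add: div_mult2_eq mult_ac)
  qed simp
  then show "base_angle p (n + m) (Suc k) \<le> \<gamma>" "len (n + m) k \<le> len n (k div 2^m) * ratio \<gamma> ^ m"
    by auto
qed

section \<open>Separation of caps of the same level\<close>

lemma left_child_far:
  assumes "k < 2^n" "P \<in> cap p (Suc n) (Suc (2 * k))"
  shows "len n k \<le> 2 * dist P (p n (Suc k))"
  using assms tip_child_far[of "height n k" "height (Suc n) (2 * k)" P "p n k" "p n (Suc k)"]
    height_le[of k n] height_le[of "2 * k" "Suc n"]
  by (simp add: cap_eq_even height(2) len_def)

lemma right_child_far:
  assumes "k < 2^n" "P \<in> cap p (Suc n) (Suc (Suc (2 * k)))"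
  shows "len n k \<le> 2 * dist P (p n k)"
  using assms tip_child_far[of "- height n k" "- height (Suc n) (Suc (2 * k))" P "p n (Suc k)" "p n k"]
    height_le[of k n] height_le[of "Suc (2 * k)" "Suc n"]
  by (simp add: cap_eq_odd height(2) len_def tip_swap dist_commute insert_commute)

lemma siblings_far:
  assumes "k < 2^n" "P \<in> cap p (Suc n) (Suc (2 * k))" "Q \<in> cap p (Suc n) (Suc (Suc (2 * k)))"
  shows "dist P (p (Suc n) (Suc (2 * k))) \<le> dist P Q" "dist Q (p (Suc n) (Suc (2 * k))) \<le> dist P Q"
  using dist_ge_of_obtuse[OF tip_siblings_obtuse[of "height n k" "height (Suc n) (2 * k)"
      "height (Suc n) (Suc (2 * k))" _ "p n k" "p n (Suc k)" P Q]] assms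
    height_le[of k n] height_le[of "2 * k" "Suc n"] height_le[of "Suc (2 * k)" "Suc n"]
  by (simp_all add: cap_eq_even cap_eq_odd height(2))

text \<open>Siblings meet only at their common vertex by \<open>siblings_far\<close> with both
  points equal. For different parents, induction places \<open>P\<close> at the vertex shared by two
  consecutive parents; the outer child of either parent stays away from it, so the two caps are the
  inner children, which are again consecutive.\<close>

lemma caps_inter:
  assumes "k < k'" "k' < 2^n" "P \<in> cap p n (Suc k)" "P \<in> cap p n (Suc k')"
  shows "k' = Suc k \<and> P = p n k'"
  using assms
proof (induction n arbitrary: k k')
  case (Suc n)
  have j: "k div 2 \<le> k' div 2" "k div 2 < 2^n" "k' div 2 < 2^n"
    using Suc.prems by (auto intro: div_le_mono)
  have P: "P \<in> cap p n (Suc (k div 2))" "P \<in> cap p n (Suc (k' div 2))"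
    using cap_child[of k n] cap_child[of k' n] Suc.prems by auto
  show ?case
  proof (cases "k div 2 = k' div 2")
    case True
    then have k: "k = 2 * (k div 2)" "k' = Suc (2 * (k div 2))" using Suc.prems(1) by auto
    have "P = p (Suc n) (Suc (2 * (k div 2)))"
      using siblings_far(1)[of "k div 2" n P P] Suc.prems(3,4) j(2) k by simp
    then show ?thesis using k by simp
  next
    case False
    then have k': "k' div 2 = Suc (k div 2)" "P = p n (k' div 2)"
      using Suc.IH[OF _ j(3) P] j(1) by auto
    have "k \<noteq> 2 * (k div 2)"
    proof
      assume "k = 2 * (k div 2)"
      then have "len n (k div 2) \<le> 0"
        using left_child_far[OF j(2), of P] Suc.prems(3) k' by simp
      then show False using len_pos[OF j(2)] by simp
    qed
    moreover have "k' \<noteq> Suc (2 * (k' div 2))"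
    proof
      assume "k' = Suc (2 * (k' div 2))"
      then have "len n (k' div 2) \<le> 0"
        using right_child_far[OF j(3), of P] Suc.prems(4) k'(2) by simp
      then show False using len_pos[OF j(3)] by simp
    qed
    ultimately have k: "k = Suc (2 * (k div 2))" "k' = 2 * (k' div 2)" by linarith+
    then have "k' = Suc k" using k'(1) by linarith
    moreover have "P = p (Suc n) k'" using even_vertex[of "k' div 2" n] j(3) k'(2) k(2) by simp
    ultimately show ?thesis by simp
  qed
qed simp

end

section \<open>The curve and the inverse Hoelder estimate\<close>

lemma nonpos_of_le_half_powers:
  fixes x :: real assumes "\<And>m. x \<le> 1 / 2^m" shows "x \<le> 0"
proof (rule LIMSEQ_le_const)
  show "(\<lambda>m. (1/2)^m) \<longlonglongrightarrow> (0::real)" by (rule LIMSEQ_power_zero) simp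
qed (use assms in \<open>auto simp: power_one_over\<close>)

text \<open>Both end points are admitted, so an interior dyadic \<open>t\<close> has two paths, one through the caps on
  either side of the vertex at \<open>t\<close>.\<close>

definition dyadic_path :: "(nat \<Rightarrow> nat) \<Rightarrow> real \<Rightarrow> bool" where
  "dyadic_path \<kappa> t \<longleftrightarrow> (\<forall>n. \<kappa> n < 2^n \<and> \<kappa> (Suc n) div 2 = \<kappa> n \<and>
     real (\<kappa> n) \<le> t * 2^n \<and> t * 2^n \<le> real (\<kappa> n) + 1)"

lemma dyadic_pathD:
  assumes "dyadic_path \<kappa> t"
  shows "\<kappa> n < 2^n" "\<kappa> (Suc n) div 2 = \<kappa> n" "real (\<kappa> n) \<le> t * 2^n" "t * 2^n \<le> real (\<kappa> n) + 1"
  using assms by (auto simp: dyadic_path_def)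

lemma dyadic_path_Suc:
  assumes "dyadic_path \<kappa> t" shows "\<kappa> (Suc n) = 2 * \<kappa> n \<or> \<kappa> (Suc n) = Suc (2 * \<kappa> n)"
  using dyadic_pathD(2)[OF assms, of n] by linarith

lemma ex_dyadic_path_of_indices:
  assumes \<kappa>: "\<And>n. \<kappa> n < 2^n" "\<And>n. \<kappa> (Suc n) div 2 = \<kappa> n"
  obtains t where "0 \<le> t" "t \<le> 1" "dyadic_path \<kappa> t"
proof -
  define a where "a n = real (\<kappa> n) / 2^n" for n
  define b where "b n = (real (\<kappa> n) + 1) / 2^n" for n
  have two: "2 * \<kappa> n \<le> \<kappa> (Suc n)" "\<kappa> (Suc n) \<le> 2 * \<kappa> n + 1" for n using \<kappa>(2)[of n] by linarith+
  have "real (2 * \<kappa> n) \<le> real (\<kappa> (Suc n))" "real (\<kappa> (Suc n)) \<le> real (2 * \<kappa> n + 1)" for n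
    using two[of n] of_nat_le_iff by blast+
  then have "real (2 * \<kappa> n) / 2^Suc n \<le> a (Suc n)" "b (Suc n) \<le> (real (2 * \<kappa> n + 1) + 1) / 2^Suc n" for n
    unfolding a_def b_def by (intro divide_right_mono add_right_mono; simp)+
  moreover have "real (2 * \<kappa> n) / 2^Suc n = a n" "(real (2 * \<kappa> n + 1) + 1) / 2^Suc n = b n" for n
    by (simp_all add: a_def b_def divide_simps)
  ultimately have "a n \<le> a (Suc n)" "b (Suc n) \<le> b n" for n by metis+
  then have mono: "incseq a" "decseq b" by (auto intro: incseq_SucI decseq_SucI)
  have ab: "a n \<le> b n" for n by (simp add: a_def b_def divide_right_mono)
  have abm: "a n \<le> b m" for n m
    using incseqD[OF mono(1), of n "max n m"] decseqD[OF mono(2), of m "max n m"] ab[of "max n m"]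
    by simp
  define t where "t = (SUP n. a n)"
  have "a n \<le> t" for n
    unfolding t_def using abm[of _ 0] by (intro cSUP_upper bdd_aboveI[of _ "b 0"]) auto
  moreover have "t \<le> b n" for n unfolding t_def using abm by (intro cSUP_least) auto
  moreover have "a 0 = 0" "b 0 = 1" using \<kappa>(1)[of 0] by (simp_all add: a_def b_def)
  ultimately have "0 \<le> t" "t \<le> 1" "\<And>n. real (\<kappa> n) / 2^n \<le> t" "\<And>n. t \<le> (real (\<kappa> n) + 1) / 2^n"
    unfolding a_def b_def by metis+
  moreover from this(3,4) have "dyadic_path \<kappa> t"
    using \<kappa> by (simp add: dyadic_path_def pos_divide_le_eq pos_le_divide_eq)
  ultimately show ?thesis using that by blast
qed

text \<open>At an interior dyadic parameter this is the path on the right of the vertex. Halving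
  commutes with the floor, with the minimum, and sends the last index to the last index, which gives
  the parent relation.\<close>

lemma dyadic_path_floor:
  assumes "0 \<le> t" "t \<le> 1"
  shows "dyadic_path (\<lambda>n. min (nat \<lfloor>t * 2^n\<rfloor>) (2^n - 1)) t"
  unfolding dyadic_path_def
proof (intro allI conjI)
  fix n
  have N: "0 < (2::nat)^n" by simp
  note idx = subinterval_index[OF assms N, unfolded of_nat_power of_nat_numeral]
  show "min (nat \<lfloor>t * 2^n\<rfloor>) (2^n - 1) < 2^n" using idx(1) by simp
  show "real (min (nat \<lfloor>t * 2^n\<rfloor>) (2^n - 1)) \<le> t * 2^n"
    "t * 2^n \<le> real (min (nat \<lfloor>t * 2^n\<rfloor>) (2^n - 1)) + 1"
    using idx(2,3) by simp_all
  have "\<lfloor>t * 2^n\<rfloor> = \<lfloor>t * 2^Suc n / real_of_int 2\<rfloor>" by simp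
  also have "\<dots> = \<lfloor>t * 2^Suc n\<rfloor> div 2" by (rule floor_divide_real_eq_div) simp
  finally have "nat \<lfloor>t * 2^n\<rfloor> = nat \<lfloor>t * 2^Suc n\<rfloor> div 2"
    using assms by (simp add: nat_div_distrib)
  moreover have "min x y div 2 = min (x div 2) (y div 2)" for x y :: nat
    by (auto simp: min_def div_le_mono dest: antisym intro: div_le_mono)
  moreover have "(2^Suc n - 1) div 2 = (2^n - 1 :: nat)"
    by (cases n) auto
  ultimately show "min (nat \<lfloor>t * 2^Suc n\<rfloor>) (2^Suc n - 1) div 2 =
      min (nat \<lfloor>t * 2^n\<rfloor>) (2^n - 1)"
    by simp
qed

context koch_system
begin

section \<open>Points of the base segment and the limit map\<close>

lemma point_inject: "point s = point t \<longleftrightarrow> s = t"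
  using distinct_vertices[of 0 0] by (simp add: point_def)

lemma dist_point: "dist (point s) (point t) = \<bar>s - t\<bar> * len 0 0"
proof -
  have "point s - point t = (s - t) *\<^sub>R (p 0 1 - p 0 0)"
    by (simp add: point_def scaleR_left_diff_distrib)
  then show ?thesis by (simp add: dist_norm len_def norm_minus_commute)
qed

lemma base_eq: "base p 0 (Suc 0) = point ` {0..1}"
proof -
  have "point t = (1 - t) *\<^sub>R p 0 0 + t *\<^sub>R p 0 1" for t
    by (simp add: point_def scaleR_left_diff_distrib scaleR_right_diff_distrib)
  then show ?thesis unfolding base_def closed_segment_def by auto
qed

lemma subdivision_combination:
  "(1 - w) *\<^sub>R subdivision p n k + w *\<^sub>R subdivision p n (Suc k) = point ((real k + w) / 2^n)"
proof -
  have "subdivision p n (Suc k) = subdivision p n k + (1 / 2^n) *\<^sub>R (p 0 1 - p 0 0)"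
    by (simp add: subdivision_def add_divide_distrib scaleR_left_distrib)
  then have "(1 - w) *\<^sub>R subdivision p n k + w *\<^sub>R subdivision p n (Suc k) =
      subdivision p n k + (w / 2^n) *\<^sub>R (p 0 1 - p 0 0)"
    by (simp add: scaleR_left_diff_distrib scaleR_right_distrib)
  also have "\<dots> = point ((real k + w) / 2^n)"
    by (simp add: subdivision_def point_def add_divide_distrib scaleR_left_distrib)
  finally show ?thesis .
qed

text \<open>The description in \<open>polygon_map\<close> is ambiguous only at subdivision points,
  which end one piece (\<open>t = 1\<close>) and start the next (\<open>t = 0\<close>); both
  representations yield the same vertex.\<close>

lemma polygon_map_point:
  assumes k: "k < 2^n" and w: "0 \<le> w" "w \<le> 1"
  shows "polygon_map p n (point ((real k + w) / 2^n)) = (1 - w) *\<^sub>R p n k + w *\<^sub>R p n (Suc k)"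
  unfolding polygon_map_def
proof (rule the_equality)
  show "\<exists>i\<in>{1..2^n}. \<exists>t\<in>{0..1}.
      point ((real k + w) / 2^n) =
        (1 - t) *\<^sub>R subdivision p n (i - 1) + t *\<^sub>R subdivision p n i \<and>
      (1 - w) *\<^sub>R p n k + w *\<^sub>R p n (Suc k) = (1 - t) *\<^sub>R p n (i - 1) + t *\<^sub>R p n i"
    using k w by (intro bexI[of _ "Suc k"] bexI[of _ w]) (auto simp: subdivision_combination)
next
  fix y
  assume "\<exists>i\<in>{1..2^n}. \<exists>t\<in>{0..1}.
      point ((real k + w) / 2^n) =
        (1 - t) *\<^sub>R subdivision p n (i - 1) + t *\<^sub>R subdivision p n i \<and>
      y = (1 - t) *\<^sub>R p n (i - 1) + t *\<^sub>R p n i"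
  then obtain i t where i: "i \<in> {1..2^n}" "0 \<le> t" "t \<le> 1"
    "point ((real k + w) / 2^n) = (1 - t) *\<^sub>R subdivision p n (i - 1) + t *\<^sub>R subdivision p n i"
    "y = (1 - t) *\<^sub>R p n (i - 1) + t *\<^sub>R p n i" by auto
  obtain j where j: "i = Suc j" using i(1) by (cases i) auto
  have "point ((real k + w) / 2^n) = point ((real j + t) / 2^n)"
    using i(4) by (simp add: j subdivision_combination)
  then have eq: "real k + w = real j + t" by (simp add: point_inject)
  consider "j = k" | "j < k" | "k < j" by linarith
  then show "y = (1 - w) *\<^sub>R p n k + w *\<^sub>R p n (Suc k)"
  proof cases
    case 1
    then show ?thesis using eq i(5) by (simp add: j)
  next
    case 2
    then have "real j + 1 \<le> real k" by linarith
    then have "real j + 1 = real k" "t = 1" "w = 0" using eq i w by linarith+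
    moreover from this have "Suc j = k" by linarith
    ultimately show ?thesis using i(5) by (simp add: j)
  next
    case 3
    then have "real k + 1 \<le> real j" by linarith
    then have "real k + 1 = real j" "t = 0" "w = 1" using eq i w by linarith+
    moreover from this have "Suc k = j" by linarith
    ultimately show ?thesis using i(5) by (simp add: j)
  qed
qed

lemma polygon_map_mem:
  assumes "dyadic_path \<kappa> t" shows "polygon_map p n (point t) \<in> cap p n (Suc (\<kappa> n))"
proof -
  note \<kappa> = dyadic_pathD[OF assms, of n]
  define w where "w = t * 2^n - real (\<kappa> n)"
  have w: "0 \<le> w" "w \<le> 1" using \<kappa> by (auto simp: w_def)
  have "t = (real (\<kappa> n) + w) / 2^n" by (simp add: w_def)
  then have "polygon_map p n (point t) \<in> closed_segment (p n (\<kappa> n)) (p n (Suc (\<kappa> n)))"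
    using polygon_map_point[OF \<kappa>(1) w] w by (auto simp: in_segment)
  then show ?thesis using segment_subset_cap by blast
qed

lemma path_cap_mono:
  assumes "dyadic_path \<kappa> t" shows "cap p (n + m) (Suc (\<kappa> (n + m))) \<subseteq> cap p n (Suc (\<kappa> n))"
proof (induction m)
  case (Suc m)
  have "cap p (Suc (n + m)) (Suc (\<kappa> (Suc (n + m)))) \<subseteq> cap p (n + m) (Suc (\<kappa> (n + m)))"
    using cap_child[of "\<kappa> (Suc (n + m))" "n + m"] dyadic_pathD[OF assms] by metis
  then show ?case using Suc by auto
qed simp

lemma path_cap_dist_le:
  assumes "dyadic_path \<kappa> t" "x \<in> cap p n (Suc (\<kappa> n))" "y \<in> cap p n (Suc (\<kappa> n))"
  shows "dist x y \<le> len 0 0 * (3/4)^n"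
  using cap_dist_le[OF dyadic_pathD(1)[OF assms(1)] assms(2,3)] len_le[OF dyadic_pathD(1)[OF assms(1)]]
  by (rule order_trans)

text \<open>Along any path, all later polygon values stay in the current cap, and the caps shrink
  geometrically, so the values form a Cauchy sequence; caps are closed, so they retain the limit. At
  a dyadic parameter this applies to both paths.\<close>

lemma koch_map_mem:
  assumes \<kappa>: "dyadic_path \<kappa> t" shows "koch_map p (point t) \<in> cap p n (Suc (\<kappa> n))"
proof -
  define y where "y n = polygon_map p n (point t)" for n
  have y: "y m \<in> cap p n (Suc (\<kappa> n))" if "n \<le> m" for n m
    using polygon_map_mem[OF \<kappa>, of m] path_cap_mono[OF \<kappa>, of n "m - n"] that by (auto simp: y_def)
  have "Cauchy y"
  proof (rule metric_CauchyI)
    fix e :: real assume "0 < e"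
    then obtain N where N: "len 0 0 * (3/4)^N < e"
      using order_tendstoD(2)[OF len_tendsto_0] by (auto simp: eventually_sequentially)
    have "dist (y m) (y n) < e" if "N \<le> m" "N \<le> n" for m n
      using path_cap_dist_le[OF \<kappa> y[OF that(1)] y[OF that(2)]] N by simp
    then show "\<exists>M. \<forall>m\<ge>M. \<forall>n\<ge>M. dist (y m) (y n) < e" by blast
  qed
  then obtain l where l: "y \<longlonglongrightarrow> l" using Cauchy_convergent convergent_def by blast
  then have "koch_map p (point t) = l" by (simp add: koch_map_def y_def[symmetric] limI)
  moreover have "l \<in> cap p n (Suc (\<kappa> n))"
    using closed_cap _ trivial_limit_sequentially l
    by (rule Lim_in_closed_set) (use y in \<open>auto simp: eventually_sequentially\<close>)
  ultimately show ?thesis by simp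
qed

lemma path_cap_unique:
  assumes "dyadic_path \<kappa> t" "\<And>n. x \<in> cap p n (Suc (\<kappa> n))" "\<And>n. y \<in> cap p n (Suc (\<kappa> n))"
  shows "x = y"
proof -
  have "dist x y \<le> 0"
    using path_cap_dist_le[OF assms(1) assms(2,3)] by (intro LIMSEQ_le_const[OF len_tendsto_0]) auto
  then show ?thesis by simp
qed

text \<open>Consider the last level at which the path still touches the vertex. There it turns left,
  so the image lies in the child away from the vertex, at least half a base from it, while the
  parameter is still within one dyadic interval of the vertex parameter.\<close>

lemma right_end_far:
  assumes \<kappa>: "dyadic_path \<kappa> t" and ne: "t * 2^n \<noteq> real (\<kappa> n) + 1"
  shows "\<exists>m. (real (\<kappa> n) + 1) / 2^n - t \<le> 1 / 2^m \<and>
    len m (\<kappa> m) \<le> 2 * dist (koch_map p (point t)) (p n (Suc (\<kappa> n)))"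
proof -
  define z where "z = (real (\<kappa> n) + 1) / 2^n"
  \<comment> \<open>\<open>Q m\<close> says that after \<open>m\<close> further levels the path is
    still in the last descendant, the one ending at \<open>p n (Suc (\<kappa> n))\<close>.\<close>
  define Q where "Q m \<longleftrightarrow> \<kappa> (n + m) + 1 = (\<kappa> n + 1) * 2^m" for m
  have z: "z - t \<le> 1 / 2^(n + m)" if "Q m" for m
  proof -
    have "real (\<kappa> (n + m) + 1) = real ((\<kappa> n + 1) * 2^m)" using that unfolding Q_def by presburger
    moreover have "z * 2^(n + m) = (real (\<kappa> n) + 1) * 2^m"
      unfolding z_def power_add mult.assoc[symmetric] by simp
    ultimately have "z * 2^(n + m) = real (\<kappa> (n + m)) + 1" by (simp add: distrib_right)
    then have "(z - t) * 2^(n + m) \<le> 1"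
      using dyadic_pathD(3)[OF \<kappa>, of "n + m"] by (simp add: left_diff_distrib)
    then show ?thesis by (simp add: field_simps)
  qed
  have "\<not> (\<forall>m. Q m)"
  proof
    assume "\<forall>m. Q m"
    then have "z - t \<le> 1 / 2^m" for m
      using z[of m] by (rule_tac order_trans[of _ "1 / 2^(n + m)"]) (auto simp: divide_simps)
    then have "z - t \<le> 0" by (rule nonpos_of_le_half_powers)
    then have "real (\<kappa> n) + 1 \<le> t * 2^n" by (simp add: z_def field_simps)
    then show False using ne dyadic_pathD(4)[OF \<kappa>, of n] by simp
  qed
  moreover have "Q 0" by (simp add: Q_def)
  ultimately obtain m where m: "Q m" "\<not> Q (Suc m)" using nat_induct[of Q] by blast
  have even: "\<kappa> (Suc (n + m)) = 2 * \<kappa> (n + m)"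
    using dyadic_path_Suc[OF \<kappa>, of "n + m"] m by (auto simp: Q_def)
  have "p (n + m) (Suc (\<kappa> (n + m))) = p n (Suc (\<kappa> n))"
    using vertex_refine[of "Suc (\<kappa> n)" n m] m(1) dyadic_pathD(1)[OF \<kappa>, of n] by (simp add: Q_def)
  then have "len (n + m) (\<kappa> (n + m)) \<le> 2 * dist (koch_map p (point t)) (p n (Suc (\<kappa> n)))"
    using left_child_far[OF dyadic_pathD(1)[OF \<kappa>, of "n + m"], of "koch_map p (point t)"]
      koch_map_mem[OF \<kappa>, of "Suc (n + m)"] even by simp
  then show ?thesis using z[OF m(1)] unfolding z_def by blast
qed

text \<open>Mirror image of \<open>right_end_far\<close>: the path follows the first descendants,
  with index \<open>\<kappa> n * 2^m\<close>, until it turns right.\<close>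

lemma left_end_far:
  assumes \<kappa>: "dyadic_path \<kappa> t" and ne: "t * 2^n \<noteq> real (\<kappa> n)"
  shows "\<exists>m. t - real (\<kappa> n) / 2^n \<le> 1 / 2^m \<and>
    len m (\<kappa> m) \<le> 2 * dist (koch_map p (point t)) (p n (\<kappa> n))"
proof -
  define z where "z = real (\<kappa> n) / 2^n"
  define Q where "Q m \<longleftrightarrow> \<kappa> (n + m) = \<kappa> n * 2^m" for m
  have z: "t - z \<le> 1 / 2^(n + m)" if "Q m" for m
  proof -
    have "real (\<kappa> (n + m)) = real (\<kappa> n * 2^m)" using that unfolding Q_def by presburger
    then have "z * 2^(n + m) = real (\<kappa> (n + m))" by (simp add: z_def power_add)
    then have "(t - z) * 2^(n + m) \<le> 1"
      using dyadic_pathD(4)[OF \<kappa>, of "n + m"] by (simp add: left_diff_distrib)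
    then show ?thesis by (simp add: field_simps)
  qed
  have "\<not> (\<forall>m. Q m)"
  proof
    assume "\<forall>m. Q m"
    then have "t - z \<le> 1 / 2^m" for m
      using z[of m] by (rule_tac order_trans[of _ "1 / 2^(n + m)"]) (auto simp: divide_simps)
    then have "t - z \<le> 0" by (rule nonpos_of_le_half_powers)
    then have "t * 2^n \<le> real (\<kappa> n)" by (simp add: z_def field_simps)
    then show False using ne dyadic_pathD(3)[OF \<kappa>, of n] by simp
  qed
  moreover have "Q 0" by (simp add: Q_def)
  ultimately obtain m where m: "Q m" "\<not> Q (Suc m)" using nat_induct[of Q] by blast
  have odd: "\<kappa> (Suc (n + m)) = Suc (2 * \<kappa> (n + m))"
    using dyadic_path_Suc[OF \<kappa>, of "n + m"] m by (auto simp: Q_def)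
  have "p (n + m) (\<kappa> (n + m)) = p n (\<kappa> n)"
    using vertex_refine[of "\<kappa> n" n m] m(1) dyadic_pathD(1)[OF \<kappa>, of n] by (simp add: Q_def)
  then have "len (n + m) (\<kappa> (n + m)) \<le> 2 * dist (koch_map p (point t)) (p n (\<kappa> n))"
    using right_child_far[OF dyadic_pathD(1)[OF \<kappa>, of "n + m"], of "koch_map p (point t)"]
      koch_map_mem[OF \<kappa>, of "Suc (n + m)"] odd by simp
  then show ?thesis using z[OF m(1)] unfolding z_def by blast
qed

text \<open>The two paths split below some cap, and the vertex \<open>v\<close> between its children
  has parameter \<open>z\<close> between \<open>s\<close> and \<open>t\<close>. The gaps
  \<open>z - s\<close> and \<open>t - z\<close> are bounded separately through the distances to
  \<open>v\<close>, whence the leading factor 2.\<close>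

lemma Hoelder_estimate:
  assumes \<kappa>: "dyadic_path \<kappa> s" "dyadic_path \<kappa>' t" and "s < t"
    and \<gamma>: "0 \<le> \<gamma>" "\<gamma> < pi / 4"
    and len: "\<And>n. len 0 0 * ratio \<gamma> ^ n \<le> len n (\<kappa> n)" "\<And>n. len 0 0 * ratio \<gamma> ^ n \<le> len n (\<kappa>' n)"
  shows "t - s \<le> 2 * (2 / len 0 0) powr koch_f1 \<gamma> *
    dist (koch_map p (point s)) (koch_map p (point t)) powr koch_f1 \<gamma>"
proof -
  define \<sigma> where "\<sigma> = koch_f1 \<gamma>"
  have \<sigma>: "1 \<le> \<sigma>" using koch_f1_ge_1[OF \<gamma>] by (simp add: \<sigma>_def)
  have r: "0 < ratio \<gamma>" using ratio_bounds(1)[OF \<gamma>] by simp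
  have L: "0 < len 0 0" using len_pos by simp
  define D where "D = dist (koch_map p (point s)) (koch_map p (point t))"
  \<comment> \<open>As \<open>ratio \<gamma> powr \<sigma>\<close> is 1/2, the parameter gap
    \<open>1 / 2^m\<close> is exactly the \<open>\<sigma>\<close>-th power of
    \<open>ratio \<gamma> ^ m\<close>; the 2 inside the power comes from the half base in the far
    estimates.\<close>
  have step: "x \<le> (2 / len 0 0) powr \<sigma> * D powr \<sigma>"
    if "x \<le> 1 / 2^m" "len 0 0 * ratio \<gamma> ^ m \<le> 2 * d" "d \<le> D" for x m d
  proof -
    have "x \<le> (ratio \<gamma> powr \<sigma>) ^ m"
      using that(1) by (simp add: \<sigma>_def ratio_powr_koch_f1[OF \<gamma>] power_one_over)
    also have "\<dots> = (ratio \<gamma> ^ m) powr \<sigma>" using r by (simp add: powr_powr mult.commute flip: powr_realpow)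
    also have "\<dots> \<le> (2 / len 0 0 * D) powr \<sigma>"
    proof (rule powr_mono2)
      have "len 0 0 * ratio \<gamma> ^ m \<le> 2 * D" using that(2,3) by linarith
      then show "ratio \<gamma> ^ m \<le> 2 / len 0 0 * D" using L by (simp add: field_simps)
    qed (use r \<sigma> in auto)
    also have "\<dots> = (2 / len 0 0) powr \<sigma> * D powr \<sigma>" by (rule powr_mult)
    finally show ?thesis .
  qed
  have "\<exists>n. \<kappa> n \<noteq> \<kappa>' n"
  proof (rule ccontr)
    assume "\<nexists>n. \<kappa> n \<noteq> \<kappa>' n"
    then have "t * 2^m \<le> s * 2^m + 1" for m
      using dyadic_pathD(3)[OF \<kappa>(1), of m] dyadic_pathD(4)[OF \<kappa>(2), of m] by (simp add: order_trans)
    then have "t - s \<le> 1 / 2^m" for m by (simp add: field_simps)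
    then have "t - s \<le> 0" by (rule nonpos_of_le_half_powers)
    then show False using \<open>s < t\<close> by simp
  qed
  moreover have "\<kappa> 0 = \<kappa>' 0" using dyadic_pathD(1)[OF \<kappa>(1), of 0] dyadic_pathD(1)[OF \<kappa>(2), of 0] by simp
  ultimately obtain n where n: "\<kappa> n = \<kappa>' n" "\<kappa> (Suc n) \<noteq> \<kappa>' (Suc n)"
    using nat_induct[of "\<lambda>n. \<kappa> n = \<kappa>' n"] by blast
  define k where "k = \<kappa> n"
  have k: "k < 2^n" using dyadic_pathD(1)[OF \<kappa>(1)] by (simp add: k_def)
  have lt: "s * 2^Suc n < t * 2^Suc n" using \<open>s < t\<close> by (rule mult_strict_right_mono) simp
  \<comment> \<open>The swapped order would put \<open>s\<close> at or beyond the midpoint of the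
    common interval and \<open>t\<close> at or before it.\<close>
  have "\<not> (\<kappa> (Suc n) = Suc (2 * k) \<and> \<kappa>' (Suc n) = 2 * k)"
  proof
    assume swapped: "\<kappa> (Suc n) = Suc (2 * k) \<and> \<kappa>' (Suc n) = 2 * k"
    have "real (Suc (2 * k)) \<le> s * 2^Suc n" "t * 2^Suc n \<le> real (2 * k) + 1"
      using dyadic_pathD(3)[OF \<kappa>(1), of "Suc n"] dyadic_pathD(4)[OF \<kappa>(2), of "Suc n"] swapped
      by (simp_all only:)
    then show False using lt by (simp only: of_nat_Suc)
  qed
  then have ch: "\<kappa> (Suc n) = 2 * k" "\<kappa>' (Suc n) = Suc (2 * k)"
    using dyadic_path_Suc[OF \<kappa>(1), of n] dyadic_path_Suc[OF \<kappa>(2), of n] n by (auto simp: k_def)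
  define z where "z = (2 * real k + 1) / 2^Suc n"
  define v where "v = p (Suc n) (Suc (2 * k))"
  have P: "koch_map p (point s) \<in> cap p (Suc n) (Suc (2 * k))"
    "koch_map p (point t) \<in> cap p (Suc n) (Suc (Suc (2 * k)))"
    using koch_map_mem[OF \<kappa>(1), of "Suc n"] koch_map_mem[OF \<kappa>(2), of "Suc n"] ch by auto
  note far = siblings_far[OF k P, folded D_def v_def]
  have nonneg: "0 \<le> (2 / len 0 0) powr \<sigma> * D powr \<sigma>" by simp
  have "z - s \<le> (2 / len 0 0) powr \<sigma> * D powr \<sigma>"
  proof (cases "s * 2^Suc n = real (\<kappa> (Suc n)) + 1")
    case True
    then have "z - s = 0" by (simp add: z_def ch field_simps)
    then show ?thesis using nonneg by simp
  next
    case False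
    then obtain m where m: "z - s \<le> 1 / 2^m" "len m (\<kappa> m) \<le> 2 * dist (koch_map p (point s)) v"
      using right_end_far[OF \<kappa>(1) False] by (auto simp: z_def ch v_def)
    show ?thesis by (rule step[OF m(1) order_trans[OF len(1) m(2)] far(1)])
  qed
  moreover have "t - z \<le> (2 / len 0 0) powr \<sigma> * D powr \<sigma>"
  proof (cases "t * 2^Suc n = real (\<kappa>' (Suc n))")
    case True
    then have "t - z = 0" by (simp add: z_def ch field_simps)
    then show ?thesis using nonneg by simp
  next
    case False
    then obtain m where m: "t - z \<le> 1 / 2^m" "len m (\<kappa>' m) \<le> 2 * dist (koch_map p (point t)) v"
      using left_end_far[OF \<kappa>(2) False] by (auto simp: z_def ch v_def add.commute)
    show ?thesis by (rule step[OF m(1) order_trans[OF len(2) m(2)] far(2)])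
  qed
  ultimately show ?thesis by (simp add: \<sigma>_def D_def)
qed

end

section \<open>Dimension bounds for a family of caps\<close>

context koch_system
begin

section \<open>Limit angles and the choice of the cap index\<close>

lemma base_angle_path_le:
  assumes "dyadic_path \<kappa> t"
  shows "base_angle p (Suc n) (Suc (\<kappa> (Suc n))) \<le> base_angle p n (Suc (\<kappa> n))"
  using base_angle_child[OF dyadic_pathD(1)[OF assms]] unfolding dyadic_pathD(2)[OF assms] .

text \<open>Angles decrease along the path and are nonnegative, so the \<open>lim\<close> in
  \<open>limit_angle\<close> is a genuine limit and a lower bound for all of them.\<close>

lemma limit_angle_path:
  assumes \<kappa>: "dyadic_path \<kappa> t" and idx: "\<And>n. cap_index p n (point t) = Suc (\<kappa> n)"
  shows "(\<lambda>n. base_angle p n (Suc (\<kappa> n))) \<longlonglongrightarrow> limit_angle p (point t)"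
    and "limit_angle p (point t) \<le> base_angle p n (Suc (\<kappa> n))"
    and "0 \<le> limit_angle p (point t)"
proof -
  define a where "a n = base_angle p n (Suc (\<kappa> n))" for n
  have pos: "0 \<le> a n" for n
    using base_angle_bounds(1)[OF dyadic_pathD(1)[OF \<kappa>]] by (simp add: a_def less_imp_le)
  have dec: "decseq a" unfolding a_def by (intro decseq_SucI base_angle_path_le[OF \<kappa>])
  obtain l where l: "a \<longlonglongrightarrow> l" "\<forall>i. l \<le> a i"
    using decseq_convergent[OF dec, of 0] pos by blast
  have eq: "limit_angle p (point t) = l"
    using l(1) unfolding limit_angle_def idx a_def by (rule limI)
  show "(\<lambda>n. base_angle p n (Suc (\<kappa> n))) \<longlonglongrightarrow> limit_angle p (point t)"
    and "limit_angle p (point t) \<le> base_angle p n (Suc (\<kappa> n))"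
    using l by (simp_all add: eq a_def[abs_def])
  show "0 \<le> limit_angle p (point t)"
    unfolding eq using l(1) pos by (intro LIMSEQ_le_const[of a]) auto
qed

text \<open>The path is the floor path. A cap of larger index containing the image would be the next
  one and meet the present one only in its right end; as the parameter is strictly left of that end,
  \<open>right_end_far\<close> would force a base of length zero.\<close>

lemma cap_index_point:
  assumes "0 \<le> t" "t \<le> 1"
  obtains \<kappa> where "dyadic_path \<kappa> t" "\<And>n. cap_index p n (point t) = Suc (\<kappa> n)"
proof -
  define \<kappa> where "\<kappa> n = min (nat \<lfloor>t * 2^n\<rfloor>) (2^n - 1)" for n
  have \<kappa>: "dyadic_path \<kappa> t" unfolding \<kappa>_def[abs_def] by (rule dyadic_path_floor[OF assms])
  have strict: "t * 2^n < real (\<kappa> n) + 1" if "Suc (\<kappa> n) < 2^n" for n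
    using subinterval_index(4)[OF assms, of "2^n"] that unfolding \<kappa>_def by simp
  have "cap_index p n (point t) = Suc (\<kappa> n)" for n
    unfolding cap_index_def
  proof (rule Max_eqI)
    show "Suc (\<kappa> n) \<in> {i \<in> {1..2^n}. koch_map p (point t) \<in> cap p n i}"
      using koch_map_mem[OF \<kappa>] dyadic_pathD(1)[OF \<kappa>, of n] by (simp add: Suc_le_eq)
  next
    fix i assume i: "i \<in> {i \<in> {1..2^n}. koch_map p (point t) \<in> cap p n i}"
    obtain k where k: "i = Suc k" using i by (cases i) auto
    show "i \<le> Suc (\<kappa> n)"
    proof (rule ccontr)
      assume "\<not> i \<le> Suc (\<kappa> n)"
      then have kk: "\<kappa> n < k" "k < 2^n" using i k by auto
      then have "k = Suc (\<kappa> n) \<and> koch_map p (point t) = p n k"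
        using caps_inter[OF _ _ koch_map_mem[OF \<kappa>]] i k by auto
      then have eq: "k = Suc (\<kappa> n)" "koch_map p (point t) = p n (Suc (\<kappa> n))" by auto
      then obtain m where "len m (\<kappa> m) \<le> 0"
        using right_end_far[OF \<kappa>, of n] strict[of n] kk by auto
      then show False using len_pos[OF dyadic_pathD(1)[OF \<kappa>]] by (simp add: not_le[symmetric])
    qed
  qed simp
  with \<kappa> show ?thesis using that by blast
qed

lemma limit_angle_le: "x \<in> base p 0 1 \<Longrightarrow> limit_angle p x \<le> base_angle p 0 1"
proof -
  assume "x \<in> base p 0 1"
  then obtain t where t: "0 \<le> t" "t \<le> 1" "x = point t" by (auto simp: base_eq)
  obtain \<kappa> where \<kappa>: "dyadic_path \<kappa> t" "\<And>n. cap_index p n (point t) = Suc (\<kappa> n)"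
    using cap_index_point[OF t(1,2)] by blast
  show ?thesis using limit_angle_path(2)[OF \<kappa>, of 0] dyadic_pathD(1)[OF \<kappa>(1), of 0] t(3) by simp
qed

lemma limit_angle_nonneg: "x \<in> base p 0 1 \<Longrightarrow> 0 \<le> limit_angle p x"
proof -
  assume "x \<in> base p 0 1"
  then obtain t where t: "0 \<le> t" "t \<le> 1" "x = point t" by (auto simp: base_eq)
  then show ?thesis using cap_index_point[OF t(1,2)] limit_angle_path(3) by metis
qed

lemma koch_map_in_cap_limit: "x \<in> base p 0 1 \<Longrightarrow> koch_map p x \<in> cap_limit p"
proof -
  assume "x \<in> base p 0 1"
  then obtain t where t: "0 \<le> t" "t \<le> 1" "x = point t" by (auto simp: base_eq)
  obtain \<kappa> where \<kappa>: "dyadic_path \<kappa> t" using cap_index_point[OF t(1,2)] by blast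
  show ?thesis
    unfolding cap_limit_def t(3)
    using koch_map_mem[OF \<kappa>] dyadic_pathD(1)[OF \<kappa>] by (auto simp: Suc_le_eq intro!: bexI[of _ "Suc (\<kappa> _)"])
qed

lemma countable_cap_vertices: "countable (cap_vertices p)"
  unfolding cap_vertices_def
proof (rule countable_UN)
  fix n
  show "countable (\<Union>i\<in>{1..2^n}. {p n (i - 1), p n i, apex p n i})"
    by (rule countable_finite) simp
qed simp

text \<open>Distinct caps of one level meet only in vertices, so a nonvertex lies in exactly one cap
  per level. These indices form a path, and shrinking of the caps identifies the point with the
  image of its parameter.\<close>

lemma nonvertex_path:
  assumes y: "y \<in> cap_limit p" "y \<notin> cap_vertices p"
  obtains t \<kappa> where "0 \<le> t" "t \<le> 1" "dyadic_path \<kappa> t" "koch_map p (point t) = y"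
    "\<And>n. cap_index p n (point t) = Suc (\<kappa> n)"
proof -
  have "\<exists>k<2^n. y \<in> cap p n (Suc k)" for n
  proof -
    obtain i where i: "i \<in> {1..2^n}" "y \<in> cap p n i" using y(1) unfolding cap_limit_def by blast
    then show ?thesis by (cases i) (auto simp: Suc_le_eq)
  qed
  then obtain \<kappa> where \<kappa>: "\<And>n. \<kappa> n < 2^n" "\<And>n. y \<in> cap p n (Suc (\<kappa> n))" by metis
  have vert: "p n k \<in> cap_vertices p" if "k < 2^n" for n k
    using that unfolding cap_vertices_def by (intro UN_I[of n] UN_I[of "Suc k"]) auto
  have uniq: "k = \<kappa> n" if k: "k < 2^n" "y \<in> cap p n (Suc k)" for n k
  proof (rule ccontr)
    assume "k \<noteq> \<kappa> n"
    then have "y = p n k \<or> y = p n (\<kappa> n)"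
      using caps_inter[of k "\<kappa> n" n y] caps_inter[of "\<kappa> n" k n y] k \<kappa>[of n] by linarith
    then show False using y(2) vert k(1) \<kappa>(1) by metis
  qed
  have "\<kappa> (Suc n) div 2 = \<kappa> n" for n
  proof (rule uniq)
    show "y \<in> cap p n (Suc (\<kappa> (Suc n) div 2))" using cap_child[OF \<kappa>(1)] \<kappa>(2) by blast
  qed (use \<kappa>(1)[of "Suc n"] in auto)
  then obtain t where t: "0 \<le> t" "t \<le> 1" "dyadic_path \<kappa> t"
    using ex_dyadic_path_of_indices[OF \<kappa>(1)] by blast
  have F: "koch_map p (point t) = y"
    using path_cap_unique[OF t(3) koch_map_mem[OF t(3)] \<kappa>(2)] .
  moreover have "cap_index p n (point t) = Suc (\<kappa> n)" for n
  proof -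
    have "{i \<in> {1..2^n}. y \<in> cap p n i} = {Suc (\<kappa> n)}"
    proof (intro equalityI subsetI)
      fix i assume "i \<in> {i \<in> {1..2^n}. y \<in> cap p n i}"
      then show "i \<in> {Suc (\<kappa> n)}" using uniq[of "i - 1" n] by (cases i) (auto simp: Suc_le_eq)
    qed (use \<kappa> in \<open>auto simp: Suc_le_eq\<close>)
    then show ?thesis by (simp add: cap_index_def F)
  qed
  ultimately show ?thesis using that t by blast
qed

section \<open>Bounds below and above for the measure of the limit set\<close>

lemma len_path_ge:
  assumes \<kappa>: "dyadic_path \<kappa> t" and \<gamma>: "0 \<le> \<gamma>" "\<And>n. \<gamma> \<le> base_angle p n (Suc (\<kappa> n))"
  shows "len 0 0 * ratio \<gamma> ^ n \<le> len n (\<kappa> n)"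
proof (induction n)
  case 0
  then show ?case using dyadic_pathD(1)[OF \<kappa>, of 0] by simp
next
  case (Suc n)
  note k = dyadic_pathD(1)[OF \<kappa>]
  have "ratio \<gamma> \<le> ratio (base_angle p n (Suc (\<kappa> n)))"
    using \<gamma> base_angle_bounds(2)[OF k] by (intro ratio_mono) auto
  then have "len 0 0 * ratio \<gamma> ^ n * ratio \<gamma> \<le> len n (\<kappa> n) * ratio (base_angle p n (Suc (\<kappa> n)))"
    using Suc len_pos[OF k] by (intro mult_mono) (auto simp: ratio_def less_imp_le)
  also have "\<dots> = len (Suc n) (\<kappa> (Suc n))"
    using len_child[OF k, of n] dyadic_pathD(2)[OF \<kappa>] by simp
  finally show ?case by (simp add: mult_ac)
qed

text \<open>On this set the path chosen by \<open>cap_index\<close> has all base angles at least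
  \<gamma>, so its bases satisfy the length hypothesis of \<open>Hoelder_estimate\<close>. The extra
  factor \<open>len 0 0\<close> converts parameters into points of the base.\<close>

lemma null_of_koch_map_null:
  assumes \<gamma>: "0 \<le> \<gamma>" "\<gamma> < pi / 4"
    and null: "hausdorff_measure (koch_f1 \<gamma>) (upsilon p \<gamma>) = 0"
  shows "hausdorff_measure 1 {x \<in> base p 0 1. limit_angle p x \<ge> \<gamma>} = 0"
proof (rule hausdorff_null_inverse_Hoelder)
  define C where "C = 2 * (2 / len 0 0) powr koch_f1 \<gamma>"
  have L: "0 < len 0 0" using len_pos by simp
  show "0 < len 0 0 * C" "0 < koch_f1 \<gamma>" using L koch_f1_ge_1[OF \<gamma>] by (simp_all add: C_def)
  have path: "\<exists>\<kappa>. dyadic_path \<kappa> t \<and> (\<forall>n. len 0 0 * ratio \<gamma> ^ n \<le> len n (\<kappa> n))"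
    if "t \<in> {0..1}" "\<gamma> \<le> limit_angle p (point t)" for t
  proof -
    have t: "0 \<le> t" "t \<le> 1" using that(1) by auto
    obtain \<kappa> where \<kappa>: "dyadic_path \<kappa> t" "\<And>n. cap_index p n (point t) = Suc (\<kappa> n)"
      using cap_index_point[OF t] by blast
    then show ?thesis
      using len_path_ge[OF \<kappa>(1) \<gamma>(1) order_trans[OF that(2) limit_angle_path(2)[OF \<kappa>]]] by blast
  qed
  have main: "dist (point s) (point t) \<le>
      len 0 0 * C * dist (koch_map p (point s)) (koch_map p (point t)) powr koch_f1 \<gamma>"
    if "s < t" "s \<in> {0..1}" "t \<in> {0..1}" "\<gamma> \<le> limit_angle p (point s)" "\<gamma> \<le> limit_angle p (point t)"
    for s t
  proof -
    have "t - s \<le> C * dist (koch_map p (point s)) (koch_map p (point t)) powr koch_f1 \<gamma>"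
      using path[OF that(2,4)] path[OF that(3,5)] Hoelder_estimate[OF _ _ that(1) \<gamma>]
      unfolding C_def by blast
    then have "len 0 0 * (t - s) \<le>
        len 0 0 * (C * dist (koch_map p (point s)) (koch_map p (point t)) powr koch_f1 \<gamma>)"
      using L by (intro mult_left_mono) auto
    then show ?thesis using that(1) by (simp add: dist_point mult_ac)
  qed
  fix x y
  assume "x \<in> {x \<in> base p 0 1. limit_angle p x \<ge> \<gamma>}" "y \<in> {x \<in> base p 0 1. limit_angle p x \<ge> \<gamma>}"
  then obtain s t where st: "x = point s" "y = point t" "s \<in> {0..1}" "t \<in> {0..1}"
    "\<gamma> \<le> limit_angle p (point s)" "\<gamma> \<le> limit_angle p (point t)" by (auto simp: base_eq)
  consider "s < t" | "s = t" | "t < s" by linarith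
  then show "dist x y \<le> len 0 0 * C * dist (koch_map p x) (koch_map p y) powr koch_f1 \<gamma>"
  proof cases
    case 1 then show ?thesis using main st by blast
  next
    case 2 then show ?thesis using st by simp
  next
    case 3 then show ?thesis using main[of t s] st by (simp add: dist_commute)
  qed
qed (use null in \<open>simp add: upsilon_def\<close>)

text \<open>The set \<open>A\<close> may lack vertices while \<open>upsilon\<close> may contain
  some; adding the countably many vertices to \<open>A\<close> changes nothing at a positive
  exponent.\<close>

lemma hausdorff_dim_lower:
  assumes \<gamma>: "0 \<le> \<gamma>" "\<gamma> < pi / 4"
    and pos: "hausdorff_measure 1 {x \<in> base p 0 1. limit_angle p x \<ge> \<gamma>} \<noteq> 0"
    and A: "cap_limit p - cap_vertices p \<subseteq> A"
  shows "ereal (koch_f1 \<gamma>) \<le> hausdorff_dim A"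
proof (rule hausdorff_dim_ge, rule notI)
  assume "hausdorff_measure (koch_f1 \<gamma>) A = 0"
  moreover have "hausdorff_measure (koch_f1 \<gamma>) (cap_vertices p) = 0"
    using koch_f1_ge_1[OF \<gamma>] by (intro hausdorff_null_countable countable_cap_vertices) simp
  ultimately have "hausdorff_measure (koch_f1 \<gamma>) (A \<union> cap_vertices p) = 0" by (rule hausdorff_null_Un)
  moreover have "upsilon p \<gamma> \<subseteq> A \<union> cap_vertices p"
    using koch_map_in_cap_limit A by (auto simp: upsilon_def)
  ultimately have "hausdorff_measure (koch_f1 \<gamma>) (upsilon p \<gamma>) = 0" by (rule hausdorff_null_subset)
  then show False using null_of_koch_map_null[OF \<gamma>] pos by simp
qed

text \<open>At depth \<open>m\<close> below the cap there are \<open>2^m\<close> descendants of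
  diameter at most \<open>l * \<rho>^m\<close>, so the covering sum is
  \<open>l powr s * (2 * \<rho> powr s)^m\<close>. It tends to zero because \<open>s\<close> exceeds
  the exponent at which \<open>2 * \<rho> powr s\<close> equals 1.\<close>

lemma subtree_null:
  assumes k: "k < 2^n" and \<gamma>: "base_angle p n (Suc k) \<le> \<gamma>" "\<gamma> < pi / 4" and s: "koch_f1 \<gamma> < s"
  shows "hausdorff_measure s ((cap_limit p - cap_vertices p) \<inter> cap p n (Suc k)) = 0"
  unfolding hausdorff_null_iff
proof (intro allI impI)
  fix \<delta> :: real and e :: ennreal assume "0 < \<delta>" "0 < e"
  then obtain e' where e': "0 < e'" "e' < e" using dense by blast
  then obtain r where r: "e' = ennreal r" "0 < r"
    by (cases e') (auto simp: ennreal_less_zero_iff)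
  have \<gamma>0: "0 \<le> \<gamma>" using base_angle_bounds(1)[OF k] \<gamma>(1) by simp
  define \<rho> where "\<rho> = ratio \<gamma>"
  define l where "l = len n k"
  have \<rho>: "0 < \<rho>" "\<rho> < 1" using ratio_bounds[OF \<gamma>0 \<gamma>(2)] by (simp_all add: \<rho>_def)
  have l: "0 < l" using len_pos[OF k] by (simp add: l_def)
  have s0: "0 < s" using koch_f1_ge_1[OF \<gamma>0 \<gamma>(2)] s by simp
  have "\<rho> powr s < \<rho> powr koch_f1 \<gamma>" using \<rho> s by (simp add: powr_less_mono')
  then have q: "2 * \<rho> powr s < 1" using ratio_powr_koch_f1[OF \<gamma>0 \<gamma>(2)] by (simp add: \<rho>_def)
  have "(\<lambda>m. l * \<rho>^m) \<longlonglongrightarrow> l * 0" using \<rho> by (intro tendsto_mult tendsto_const LIMSEQ_power_zero) simp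
  moreover have "(\<lambda>m. l powr s * (2 * \<rho> powr s)^m) \<longlonglongrightarrow> l powr s * 0"
    using q by (intro tendsto_mult tendsto_const LIMSEQ_power_zero) simp
  ultimately have "eventually (\<lambda>m. l * \<rho>^m < \<delta> \<and> l powr s * (2 * \<rho> powr s)^m < r) sequentially"
    using \<open>0 < \<delta>\<close> r by (intro eventually_conj order_tendstoD(2)) auto
  then obtain m where m: "l * \<rho>^m < \<delta>" "l powr s * (2 * \<rho> powr s)^m < r"
    by (auto simp: eventually_sequentially)
  define T where "T j = cap p (n + m) (Suc (k * 2^m + j))" for j
  have T: "bounded (T j) \<and> diameter (T j) \<le> l * \<rho>^m" if j: "j < 2^m" for j
  proof -
    have div: "(k * 2^m + j) div 2^m = k" using j by simp
    have "k * 2^m + j < k * 2^m + 2^m" using j by simp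
    also have "\<dots> \<le> 2^(n + m)" using k mult_le_mono1[of "Suc k" "2^n" "2^m"] by (simp add: power_add)
    finally have lt: "k * 2^m + j < 2^(n + m)" .
    have "dist x y \<le> l * \<rho>^m" if "x \<in> T j" "y \<in> T j" for x y
      using cap_dist_le[OF lt that[unfolded T_def]] len_descendant(2)[OF lt \<gamma>(2)] \<gamma>(1) div
      by (simp add: l_def \<rho>_def)
    then show ?thesis
      using l \<rho> unfolding bounded_two_points by (intro conjI exI ballI diameter_le_dist) auto
  qed
  define C where "C j = (if j < 2^m then T j else {})" for j
  have "(cap_limit p - cap_vertices p) \<inter> cap p n (Suc k) \<subseteq> (\<Union>j. C j)"
  proof
    fix y assume "y \<in> (cap_limit p - cap_vertices p) \<inter> cap p n (Suc k)"
    then have y: "y \<in> cap_limit p" "y \<notin> cap_vertices p" "y \<in> cap p n (Suc k)" by auto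
    obtain t \<kappa> where \<kappa>: "dyadic_path \<kappa> t" "koch_map p (point t) = y"
      "\<And>n. cap_index p n (point t) = Suc (\<kappa> n)"
      using nonvertex_path[OF y(1,2)] by metis
    have mem: "y \<in> cap p i (Suc (\<kappa> i))" for i using koch_map_mem[OF \<kappa>(1)] \<kappa>(2) by simp
    \<comment> \<open>Leaving out the vertices matters here: the path of \<open>y\<close> must run
      through the given cap, since two caps of level \<open>n\<close> share at most a
      vertex.\<close>
    have "\<kappa> n = k"
    proof (rule ccontr)
      assume "\<kappa> n \<noteq> k"
      then have "y = p n k \<or> y = p n (\<kappa> n)"
        using caps_inter[of k "\<kappa> n" n y] caps_inter[of "\<kappa> n" k n y] k
          dyadic_pathD(1)[OF \<kappa>(1), of n] mem[of n] y(3) by (metis nat_neq_iff)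
      moreover have "p n i \<in> cap_vertices p" if "i < 2^n" for i
        using that unfolding cap_vertices_def by (intro UN_I[of n] UN_I[of "Suc i"]) auto
      ultimately show False using y(2) k dyadic_pathD(1)[OF \<kappa>(1), of n] by auto
    qed
    moreover have "\<kappa> (n + i) div 2^i = \<kappa> n" for i
    proof (induction i)
      case (Suc i)
      then show ?case using dyadic_pathD(2)[OF \<kappa>(1), of "n + i"] by (simp add: div_mult2_eq)
    qed simp
    ultimately have "\<kappa> (n + m) = k * 2^m + \<kappa> (n + m) mod 2^m"
      using div_mult_mod_eq[of "\<kappa> (n + m)" "2^m"] by simp
    then have "y \<in> C (\<kappa> (n + m) mod 2^m)" using mem[of "n + m"] by (simp add: C_def T_def)
    then show "y \<in> (\<Union>j. C j)" by blast
  qed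
  moreover have "bounded (C j) \<and> diameter (C j) \<le> \<delta>" for j
    using T[of j] m(1) \<open>0 < \<delta>\<close> by (auto simp: C_def)
  moreover have "(\<Sum>j. diam_power s (C j)) < e"
  proof -
    have "(\<Sum>j. diam_power s (C j)) = (\<Sum>j<2^m::nat. diam_power s (C j))"
      by (intro suminf_finite) (auto simp: C_def diam_power_def)
    also have "\<dots> \<le> (\<Sum>j<2^m::nat. ennreal ((l * \<rho>^m) powr s))"
    proof (rule sum_mono)
      fix j :: nat assume "j \<in> {..<2^m}"
      then show "diam_power s (C j) \<le> ennreal ((l * \<rho>^m) powr s)"
        using T[of j] s0 by (auto simp: C_def diam_power_def intro!: ennreal_leI powr_mono2 diameter_ge_0)
    qed
    also have "\<dots> = ennreal (2^m * (l * \<rho>^m) powr s)" by (subst sum_ennreal) auto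
    also have "2^m * (l * \<rho>^m) powr s = l powr s * (2 * \<rho> powr s)^m"
    proof -
      have "(\<rho>^m) powr s = (\<rho> powr s)^m" using \<rho> by (simp add: powr_powr mult.commute flip: powr_realpow)
      then show ?thesis by (simp add: powr_mult power_mult_distrib)
    qed
    also have "ennreal \<dots> \<le> e'" using m(2) r by (simp add: ennreal_leI)
    finally show ?thesis using e' by simp
  qed
  ultimately show "\<exists>C. (cap_limit p - cap_vertices p) \<inter> cap p n (Suc k) \<subseteq> (\<Union>j. C j) \<and>
      (\<forall>j. bounded (C j) \<and> diameter (C j) \<le> \<delta>) \<and> (\<Sum>j. diam_power s (C j)) < e" by blast
qed

text \<open>Isolates the only part not covered by countably many small-angle subtrees, so that one
  lemma serves both upper bounds: \<open>upsilon\<close> is empty beyond the second critical angle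
  and of zero length in the final claim.\<close>

lemma cap_limit_null:
  assumes \<gamma>: "0 \<le> \<gamma>" "\<gamma> < pi / 4" and s: "koch_f1 \<gamma> < s"
    and null: "hausdorff_measure s (upsilon p \<gamma>) = 0"
  shows "hausdorff_measure s (cap_limit p) = 0"
proof -
  define I where "I = {(n, k). k < 2^n \<and> base_angle p n (Suc k) \<le> \<gamma>}"
  define R where "R = (\<Union>(n, k)\<in>I. (cap_limit p - cap_vertices p) \<inter> cap p n (Suc k))"
  have "hausdorff_measure s R = 0"
    unfolding R_def using subtree_null[OF _ _ \<gamma>(2) s]
    by (intro hausdorff_null_countable_UN) (auto simp: I_def)
  moreover have "hausdorff_measure s (cap_vertices p) = 0"
    using koch_f1_ge_1[OF \<gamma>] s by (intro hausdorff_null_countable countable_cap_vertices) simp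
  ultimately have "hausdorff_measure s (R \<union> cap_vertices p \<union> upsilon p \<gamma>) = 0"
    using null by (intro hausdorff_null_Un)
  moreover have "cap_limit p \<subseteq> R \<union> cap_vertices p \<union> upsilon p \<gamma>"
  proof
    fix y assume y: "y \<in> cap_limit p"
    show "y \<in> R \<union> cap_vertices p \<union> upsilon p \<gamma>"
    proof (cases "y \<in> cap_vertices p")
      case False
      obtain t \<kappa> where t: "0 \<le> t" "t \<le> 1" and \<kappa>: "dyadic_path \<kappa> t" "koch_map p (point t) = y"
        "\<And>n. cap_index p n (point t) = Suc (\<kappa> n)"
        using nonvertex_path[OF y False] by metis
      show ?thesis
      proof (cases "limit_angle p (point t) \<ge> \<gamma>")
        case True
        then have "y \<in> upsilon p \<gamma>" using t \<kappa>(2) by (auto simp: upsilon_def base_eq)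
        then show ?thesis by simp
      next
        case less: False
        obtain n where n: "base_angle p n (Suc (\<kappa> n)) < \<gamma>"
          using order_tendstoD(2)[OF limit_angle_path(1)[OF \<kappa>(1,3)]] less
          by (auto simp: eventually_sequentially not_le)
        then have "(n, \<kappa> n) \<in> I" using dyadic_pathD(1)[OF \<kappa>(1)] by (simp add: I_def)
        moreover have "y \<in> (cap_limit p - cap_vertices p) \<inter> cap p n (Suc (\<kappa> n))"
          using y False koch_map_mem[OF \<kappa>(1), of n] \<kappa>(2) by simp
        ultimately have "y \<in> R" unfolding R_def by blast
        then show ?thesis by simp
      qed
    qed simp
  qed
  ultimately show ?thesis by (rule hausdorff_null_subset)
qed

end

section \<open>Constant base angle\<close>

text \<open>Each cap of constant base angle points into its parent, so the signed height alternates from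
  level to level.\<close>

primrec koch_vertex :: "real \<Rightarrow> nat \<Rightarrow> nat \<Rightarrow> real \<times> real" where
  "koch_vertex \<eta> 0 = (\<lambda>k. (real k, 0))"
| "koch_vertex \<eta> (Suc n) = (\<lambda>k. if even k then koch_vertex \<eta> n (k div 2)
     else tip (koch_vertex \<eta> n (k div 2)) (koch_vertex \<eta> n (Suc (k div 2))) ((-1)^n * \<eta>))"

lemma koch_vertex_distinct: "0 < \<eta> \<Longrightarrow> koch_vertex \<eta> n k \<noteq> koch_vertex \<eta> n (Suc k)"
proof (induction n arbitrary: k)
  case (Suc n)
  define h where "h = (-1)^n * \<eta>"
  have ne: "dist a b * sqrt (1/4 + h\<^sup>2) \<noteq> 0" if "a \<noteq> b" for a b :: "real \<times> real"
    using that Suc.prems by (simp add: h_def add_pos_nonneg less_imp_neq[symmetric])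
  consider j where "k = 2 * j" | j where "k = Suc (2 * j)" by (metis oddE evenE Suc_eq_plus1)
  then show ?case
  proof cases
    case 1
    then show ?thesis
      using ne[OF Suc.IH[OF Suc.prems]] dist_tip(1)[of "koch_vertex \<eta> n j" "koch_vertex \<eta> n (Suc j)" h]
      by (auto simp: h_def)
  next
    case 2
    then show ?thesis
      using ne[OF Suc.IH[OF Suc.prems]] dist_tip(2)[of "koch_vertex \<eta> n j" "koch_vertex \<eta> n (Suc j)" h]
      by (auto simp: h_def)
  qed
qed simp

text \<open>Existence for the description in \<open>Koch_curve\<close>. Nesting holds because the
  alternating sign places the apex of each child on the base of its parent.\<close>

lemma const_caps_koch_vertex:
  assumes \<eta>: "0 < \<eta>" "\<eta> < 1/100" shows "const_caps \<eta> (koch_vertex \<eta>)"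
proof -
  let ?V = "koch_vertex \<eta>"
  have apex: "apex ?V n (Suc k) = tip (?V n k) (?V n (Suc k)) ((-1)^n * \<eta>)" for n k
    by (simp add: apex_def)
  have idx: "\<exists>k. i = Suc k" if "i \<in> {1..2^n}" for i n :: nat using that by (cases i) auto
  have cap: "cap ?V n (Suc k) =
      convex hull {?V n k, ?V n (Suc k), tip (?V n k) (?V n (Suc k)) ((-1)^n * \<eta>)}" for n k
    by (simp add: cap_def apex)
  have hull: "convex hull {x, y, z} \<subseteq> convex hull S"
    if "x \<in> convex hull S" "y \<in> convex hull S" "z \<in> convex hull S" for x y z :: "real \<times> real" and S
    using that by (intro hull_minimal) auto
  have sub: "cap ?V (Suc n) (Suc (2 * k)) \<subseteq> cap ?V n (Suc k)"
    "cap ?V (Suc n) (Suc (Suc (2 * k))) \<subseteq> cap ?V n (Suc k)" for n k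
  proof -
    have "\<bar>(-1)^n * \<eta>\<bar> \<le> 1/100" using \<eta> by (simp add: abs_mult)
    note opp = tip_child_opposite[OF this, of "?V n k" "?V n (Suc k)"]
    show "cap ?V (Suc n) (Suc (2 * k)) \<subseteq> cap ?V n (Suc k)"
      unfolding cap by (rule hull) (use opp(1) in \<open>auto intro: hull_inc\<close>)
    show "cap ?V (Suc n) (Suc (Suc (2 * k))) \<subseteq> cap ?V n (Suc k)"
      unfolding cap by (rule hull) (use opp(2) in \<open>auto intro: hull_inc\<close>)
  qed
  have "nested_caps ?V"
    unfolding nested_caps_def
  proof (intro conjI allI ballI impI)
    fix n i assume i: "i \<in> {1..2^n::nat}"
    then obtain k where k: "i = Suc k" using idx by blast
    show "is_cap_apex (?V n (i - 1)) (?V n i) (apex ?V n i)"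
      unfolding k apex is_cap_apex_iff using koch_vertex_distinct[OF \<eta>(1)] \<eta>
      by (intro conjI exI[of _ "(-1)^n * \<eta>"]) auto
    fix j assume "j \<in> {2 * i - 1, 2 * i}"
    then show "cap ?V (Suc n) j \<subseteq> cap ?V n i" using sub[of n k] by (auto simp: k)
  qed auto
  moreover have "cap_height (?V 0 0) (?V 0 1) (apex ?V 0 1) = \<eta>"
    using apex[of 0 0] \<eta> cap_height_tip[of "?V 0 0" "?V 0 1" \<eta>] by (simp add: dist_prod_def)
  moreover have "0 < snd (apex ?V 0 1)" using apex[of 0 0] \<eta> by (simp add: tip_def rot_def)
  moreover have "base_angle ?V n i = arctan (2 * \<eta>)" if i: "i \<in> {1..2^n}" for n i
  proof -
    obtain k where k: "i = Suc k" using idx[OF i] by blast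
    show ?thesis
      unfolding k base_angle_def apex
      using cap_base_angle_tip[OF koch_vertex_distinct[OF \<eta>(1)]] \<eta> by (simp add: abs_mult)
  qed
  ultimately show ?thesis by (simp add: const_caps_def)
qed

text \<open>The base angle fixes the absolute value. The sign is positive at the root by hypothesis
  and must flip at each level, since the child's apex belongs to the parent's cap.\<close>

lemma const_caps_height:
  assumes u: "const_caps \<eta> u" and \<eta>: "0 < \<eta>" and k: "k < 2^n"
  shows "cap_system.height u n k = (-1)^n * \<eta>"
proof -
  interpret cap_system u using u by unfold_locales (simp add: const_caps_def)
  have abs: "\<bar>height n k\<bar> = \<eta>" if "k < 2^n" for n k
  proof -
    have "base_angle u n (Suc k) = arctan (2 * \<eta>)" using u that by (simp add: const_caps_def Suc_le_eq)
    then show ?thesis using base_angle_eq[OF that] by (simp add: arctan_eq_iff)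
  qed
  show ?thesis using k
  proof (induction n arbitrary: k)
    case 0
    have "0 < snd (apex u 0 1)" "u 0 0 = (0, 0)" "u 0 1 = (1, 0)" using u by (auto simp: const_caps_def)
    then have "0 < height 0 0" using height(2)[of 0 0] by (simp add: apex_def tip_def rot_def)
    then show ?case using abs[of 0 0] 0 by simp
  next
    case (Suc n)
    define j where "j = k div 2"
    have j: "j < 2^n" using Suc.prems by (auto simp: j_def)
    have in_cap: "u (Suc (Suc n)) (Suc (2 * k)) \<in> convex hull {u n j, u n (Suc j), tip (u n j) (u n (Suc j)) (height n j)}"
      using cap_child[OF Suc.prems] hull_inc[of "u (Suc (Suc n)) (Suc (2 * k))"]
      unfolding cap_eq j_def[symmetric] height(2)[OF j] by auto
    have "height n j * height (Suc n) k \<le> 0"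
    proof (cases "even k")
      case True
      then have "k = 2 * j" by (simp add: j_def)
      then show ?thesis
        using in_cap height(2)[OF Suc.prems] height(2)[OF j] even_vertex[of j n] j
          tip_child_inside_sign(1)[OF distinct_vertices[OF j]] by simp
    next
      case False
      then have "k = Suc (2 * j)" by (simp add: j_def)
      then show ?thesis
        using in_cap height(2)[OF Suc.prems] height(2)[OF j] even_vertex[of "Suc j" n] j
          tip_child_inside_sign(2)[OF distinct_vertices[OF j]] by simp
    qed
    moreover have "\<bar>height (Suc n) k\<bar> = \<bar>height n j\<bar>" using abs j Suc.prems by simp
    ultimately have "height (Suc n) k = - height n j"
      using \<eta> abs[OF j] by (auto simp: abs_eq_iff mult_le_0_iff)
    then show ?case using Suc.IH[OF j] by simp
  qed
qed

lemma const_caps_unique: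
  assumes u: "const_caps \<eta> u" and \<eta>: "0 < \<eta>"
  shows "k \<le> 2^n \<Longrightarrow> u n k = koch_vertex \<eta> n k"
proof (induction n arbitrary: k)
  case 0
  then have "k = 0 \<or> k = 1" by auto
  then show ?case using u by (auto simp: const_caps_def zero_prod_def)
next
  case (Suc n)
  interpret cap_system u using u by unfold_locales (simp add: const_caps_def)
  consider j where "k = 2 * j" "j \<le> 2^n" | j where "k = Suc (2 * j)" "j < 2^n"
    using Suc.prems by (cases "even k") (auto elim!: evenE oddE)
  then show ?case
  proof cases
    case 1
    then show ?thesis using even_vertex Suc.IH by simp
  next
    case 2
    then show ?thesis
      using height(2)[of j n] const_caps_height[OF u \<eta>, of j n] Suc.IH[of j] Suc.IH[of "Suc j"] by simp
  qed
qed

text \<open>The family \<open>u\<close> is determined only at indices up to \<open>2^n\<close>, but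
  caps use no others, so the limit set is unique although \<open>u\<close> is not.\<close>

lemma Koch_curve_eq:
  assumes \<eta>: "0 < \<eta>" "\<eta> < 1/100" shows "Koch_curve \<eta> = cap_limit (koch_vertex \<eta>)"
proof -
  have "cap_limit u = cap_limit (koch_vertex \<eta>)" if u: "const_caps \<eta> u" for u
  proof -
    have "cap u n i = cap (koch_vertex \<eta>) n i" if i: "i \<in> {1..2^n}" for n i
    proof -
      have "i - 1 \<le> 2^n" "i \<le> 2^n" "2 * i - 1 \<le> 2^Suc n" using i by auto
      then show ?thesis
        unfolding cap_def apex_def using const_caps_unique[OF u \<eta>(1)] by metis
    qed
    then show ?thesis by (simp add: cap_limit_def)
  qed
  then have "(THE S. \<exists>u. const_caps \<eta> u \<and> S = cap_limit u) = cap_limit (koch_vertex \<eta>)"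
    using const_caps_koch_vertex[OF \<eta>] by (rule_tac the_equality) blast+
  then show ?thesis using \<eta> by (simp add: Koch_curve_def)
qed

section \<open>Dimension of the constant-angle curves\<close>

lemma koch_caps_koch_vertex:
  assumes \<eta>: "0 < \<eta>" "\<eta> < 1/100" shows "koch_caps (koch_vertex \<eta>)"
proof -
  let ?V = "koch_vertex \<eta>"
  have c: "const_caps \<eta> ?V" by (rule const_caps_koch_vertex[OF \<eta>])
  have "hausdorff_measure 1 (base ?V 0 1) = 1"
    by (simp add: base_def hausdorff_measure_1_segment dist_prod_def)
  then have "\<exists>\<epsilon>::real. 0 < \<epsilon> \<and> \<epsilon> < 1/100 \<and>
      ennreal (cap_height (?V 0 0) (?V 0 1) (apex ?V 0 1)) = ennreal \<epsilon> * hausdorff_measure 1 (base ?V 0 1)"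
    using c \<eta> by (intro exI[of _ \<eta>]) (simp add: const_caps_def)
  moreover have "base_angle ?V (Suc n) k \<le> base_angle ?V n i"
    if "i \<in> {1..2^n}" "k \<in> {2 * i - 1, 2 * i}" for n i k
  proof -
    have "k \<in> {1..2^Suc n}" using that by auto
    then show ?thesis using c that(1) unfolding const_caps_def by (metis order_refl)
  qed
  ultimately show ?thesis using c unfolding koch_caps_def const_caps_def by blast
qed

text \<open>For \<gamma> = 0 the curve is a segment by definition. Otherwise it is itself a limit of
  Koch caps with every limit angle equal to \<gamma>: the whole base has positive length in the
  lower bound, and the root cap alone gives the upper bound.\<close>

lemma hausdorff_dim_Koch_curve:
  assumes \<gamma>: "0 \<le> \<gamma>" "\<gamma> < pi / 4" "koch_f \<gamma> < 1/100"
  shows "hausdorff_dim (Koch_curve (koch_f \<gamma>)) = ereal (koch_f1 \<gamma>)"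
proof (cases "\<gamma> = 0")
  case True
  let ?S = "closed_segment (0, 0) (1, 0) :: (real \<times> real) set"
  have H: "hausdorff_measure 1 ?S = 1"
    by (simp add: hausdorff_measure_1_segment dist_prod_def)
  have "ereal 1 \<le> hausdorff_dim ?S" by (rule hausdorff_dim_ge) (simp add: H)
  moreover have "hausdorff_dim ?S \<le> ereal 1"
    by (rule hausdorff_dim_le) (use H hausdorff_null_of_finite[of 1 ?S] in auto)
  moreover have "koch_f1 0 = 1" by (simp add: koch_f1_def ln_div)
  ultimately show ?thesis using True by (simp add: Koch_curve_def koch_f_def)
next
  case False
  define \<eta> where "\<eta> = koch_f \<gamma>"
  have "0 < tan \<gamma>" using \<gamma> False by (intro tan_gt_zero) auto
  then have \<eta>: "0 < \<eta>" "\<eta> < 1/100" using \<gamma>(3) by (simp_all add: \<eta>_def koch_f_def)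
  have arctan: "arctan (2 * \<eta>) = \<gamma>" using \<gamma> by (simp add: \<eta>_def koch_f_def arctan_tan)
  let ?V = "koch_vertex \<eta>"
  interpret koch_system ?V using koch_caps_koch_vertex[OF \<eta>] by unfold_locales
  have angle: "base_angle ?V n (Suc k) = \<gamma>" if "k < 2^n" for n k
    using const_caps_koch_vertex[OF \<eta>] that arctan by (simp add: const_caps_def Suc_le_eq)
  have "limit_angle ?V x = \<gamma>" if "x \<in> base ?V 0 1" for x
  proof -
    obtain t where t: "0 \<le> t" "t \<le> 1" "x = point t" using \<open>x \<in> base ?V 0 1\<close> by (auto simp: base_eq)
    obtain \<kappa> where \<kappa>: "dyadic_path \<kappa> t" "\<And>n. cap_index ?V n (point t) = Suc (\<kappa> n)"
      using cap_index_point[OF t(1,2)] by blast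
    have "(\<lambda>n. \<gamma>) \<longlonglongrightarrow> limit_angle ?V (point t)"
      using limit_angle_path(1)[OF \<kappa>] angle dyadic_pathD(1)[OF \<kappa>(1)] by simp
    then show ?thesis using t(3) by (simp add: LIMSEQ_const_iff)
  qed
  then have "{x \<in> base ?V 0 1. limit_angle ?V x \<ge> \<gamma>} = base ?V 0 1" by auto
  moreover have "hausdorff_measure 1 (base ?V 0 1) \<noteq> 0"
    by (simp add: base_def hausdorff_measure_1_segment)
  ultimately have "ereal (koch_f1 \<gamma>) \<le> hausdorff_dim (cap_limit ?V)"
    using \<gamma> by (intro hausdorff_dim_lower) auto
  moreover have "hausdorff_dim (cap_limit ?V) \<le> ereal (koch_f1 \<gamma>)"
  proof (rule hausdorff_dim_le)
    fix s assume s: "koch_f1 \<gamma> < s"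
    have "hausdorff_measure s ((cap_limit ?V - cap_vertices ?V) \<inter> cap ?V 0 (Suc 0)) = 0"
      using angle[of 0 0] \<gamma> s by (intro subtree_null) auto
    moreover have "hausdorff_measure s (cap_vertices ?V) = 0"
      using koch_f1_ge_1[OF \<gamma>(1,2)] s by (intro hausdorff_null_countable countable_cap_vertices) simp
    ultimately have "hausdorff_measure s
        ((cap_limit ?V - cap_vertices ?V) \<inter> cap ?V 0 (Suc 0) \<union> cap_vertices ?V) = 0"
      by (rule hausdorff_null_Un)
    moreover have "cap_limit ?V \<subseteq> cap ?V 0 (Suc 0)" unfolding cap_limit_def by (intro INF_lower2[of 0]) auto
    then have "cap_limit ?V \<subseteq>
        (cap_limit ?V - cap_vertices ?V) \<inter> cap ?V 0 (Suc 0) \<union> cap_vertices ?V" by blast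
    ultimately show "hausdorff_measure s (cap_limit ?V) = 0" by (rule hausdorff_null_subset)
  qed (use koch_f1_ge_1[OF \<gamma>(1,2)] in simp)
  ultimately show ?thesis using Koch_curve_eq[OF \<eta>] by (simp add: \<eta>_def)
qed

section \<open>The two limit angles\<close>

lemma koch_f1_near:
  assumes "0 \<le> \<gamma>" "\<gamma> < pi / 4" "0 < e"
  obtains d where "0 < d" "\<And>x. 0 \<le> x \<Longrightarrow> x < pi / 4 \<Longrightarrow> \<bar>x - \<gamma>\<bar> < d \<Longrightarrow> \<bar>koch_f1 x - koch_f1 \<gamma>\<bar> < e"
proof -
  have "\<gamma> \<in> {0..<pi/4}" using assms by simp
  then obtain d where "0 < d" "\<forall>x\<in>{0..<pi/4}. dist x \<gamma> < d \<longrightarrow> dist (koch_f1 x) (koch_f1 \<gamma>) < e"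
    using continuous_on_koch_f1 assms(3) unfolding continuous_on_iff by metis
  then show ?thesis using that[of d] by (simp add: dist_real_def)
qed

lemma (in koch_system) limit_angle_le_gamma2:
  assumes "x \<in> base p 0 1"
  shows "limit_angle p x \<le> gamma2 p"
  unfolding gamma2_def using assms by (rule cSUP_upper) (rule bdd_aboveI2, rule limit_angle_le)

theorem theorem8p9:
  fixes p :: "nat \<Rightarrow> nat \<Rightarrow> real \<times> real" and A :: "(real \<times> real) set"
  assumes "koch_type_set p A"
  shows "hausdorff_dim (Koch_curve (koch_f (gamma1 p))) = ereal (koch_f1 (gamma1 p)) \<and>
         ereal (koch_f1 (gamma1 p)) \<le> hausdorff_dim A \<and>
         hausdorff_dim A \<le> ereal (koch_f1 (gamma2 p)) \<and>
         ereal (koch_f1 (gamma2 p)) = hausdorff_dim (Koch_curve (koch_f (gamma2 p))) \<and>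
         ((\<forall>C \<subseteq> base p 0 1. hausdorff_measure 1 C = 0 \<longrightarrow> hausdorff_measure 1 (koch_map p ` C) = 0) \<or>
          hausdorff_measure 1 (upsilon p (gamma1 p)) = 0
          \<longrightarrow> hausdorff_dim A = ereal (koch_f1 (gamma1 p)))"
proof -
  interpret koch_system p using assms by unfold_locales (simp add: koch_type_set_def)
  have A: "cap_limit p - cap_vertices p \<subseteq> A" "A \<subseteq> cap_limit p"
    using assms by (auto simp: koch_type_set_def)
  define \<gamma>1 where "\<gamma>1 = gamma1 p"
  define \<gamma>2 where "\<gamma>2 = gamma2 p"
  define \<theta> where "\<theta> = base_angle p 0 1"
  define S where "S a = {x \<in> base p 0 1. limit_angle p x \<ge> a}" for a
  \<comment> \<open>The root angle dominates all limit angles, and \<open>koch_f \<theta>\<close> is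
    the absolute height of the root, so both Koch curves in the claim have parameters below
    1/100.\<close>
  have \<theta>: "0 < \<theta>" "\<theta> < pi / 4" "koch_f \<theta> < 1/100"
    using base_angle_bounds(1)[of 0 0] base_angle_small[of 0 0] base_angle_eq[of 0 0] height_0
    by (simp_all add: \<theta>_def koch_f_def tan_arctan)
  have base: "base p 0 1 \<noteq> {}" by (simp add: base_def)
  have S0: "hausdorff_measure 1 (S 0) \<noteq> 0"
  proof -
    have "S 0 = base p 0 1" using limit_angle_nonneg by (auto simp: S_def)
    then show ?thesis using distinct_vertices[of 0 0] by (simp add: base_def hausdorff_measure_1_segment)
  qed
  have S_empty: "S a = {}" if "\<theta> < a" for a
    using limit_angle_le that by (force simp: S_def \<theta>_def)
  define G where "G = {a. hausdorff_measure 1 (S a) > 0}"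
  have \<gamma>1_eq: "\<gamma>1 = Sup G" by (simp add: \<gamma>1_def gamma1_def G_def S_def)
  \<comment> \<open>A nonempty set bounded above, as real suprema require; angle 0 belongs to it
    because every limit angle is nonnegative and the base has positive length.\<close>
  have G0: "0 \<in> G" using S0 by (simp add: G_def zero_less_iff_neq_zero)
  have G_le: "a \<le> \<theta>" if "a \<in> G" for a using S_empty[of a] that by (force simp: G_def)
  have bdd: "bdd_above G" using G_le by (rule bdd_aboveI)
  have \<gamma>1: "0 \<le> \<gamma>1" "\<gamma>1 \<le> \<theta>"
    unfolding \<gamma>1_eq using G0 G_le bdd by (auto intro: cSup_upper cSup_least)
  obtain x0 where x0: "x0 \<in> base p 0 1" using base by blast
  have \<gamma>2: "0 \<le> \<gamma>2" "\<gamma>2 \<le> \<theta>"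
    using limit_angle_nonneg[OF x0] limit_angle_le_gamma2[OF x0] limit_angle_le base
    unfolding \<gamma>2_def \<theta>_def by (auto simp: gamma2_def intro: cSUP_least)
  have f_small: "koch_f \<gamma> < 1/100" "\<gamma> < pi / 4" if "0 \<le> \<gamma>" "\<gamma> \<le> \<theta>" for \<gamma>
    using tan_mono_le[of \<gamma> \<theta>] that \<theta> by (auto simp: koch_f_def)
  note small1 = f_small[OF \<gamma>1] and small2 = f_small[OF \<gamma>2]

  have above: "\<exists>a. \<gamma> < a \<and> 0 \<le> a \<and> a < pi / 4 \<and> koch_f1 a < s"
    if "0 \<le> \<gamma>" "\<gamma> < pi / 4" "koch_f1 \<gamma> < s" for \<gamma> s
  proof -
    obtain d where d: "0 < d" "\<And>x. 0 \<le> x \<Longrightarrow> x < pi / 4 \<Longrightarrow> \<bar>x - \<gamma>\<bar> < d \<Longrightarrow>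
        \<bar>koch_f1 x - koch_f1 \<gamma>\<bar> < s - koch_f1 \<gamma>"
      using koch_f1_near[of \<gamma> "s - koch_f1 \<gamma>"] \<open>0 \<le> \<gamma>\<close> \<open>\<gamma> < pi / 4\<close> \<open>koch_f1 \<gamma> < s\<close> by auto
    \<comment> \<open>Half the way in both constraints: within \<open>d\<close> of \<gamma> and
      below \<open>pi / 4\<close>.\<close>
    define a where "a = min (\<gamma> + d / 2) ((\<gamma> + pi / 4) / 2)"
    have "\<gamma> < a" "0 \<le> a" "a < pi / 4" "\<bar>a - \<gamma>\<bar> < d" using that d(1) by (auto simp: a_def min_def)
    then show ?thesis using d(2)[of a] by (intro exI[of _ a]) auto
  qed

  \<comment> \<open>If the critical angle is 0, no nonnegative angle lies below it and the whole
    base is used directly; otherwise it is approached from below, since the supremum need not be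
    attained.\<close>
  have lower: "ereal (koch_f1 \<gamma>1) \<le> hausdorff_dim A"
  proof (cases "\<gamma>1 = 0")
    case True
    then show ?thesis using hausdorff_dim_lower[OF _ _ S0[unfolded S_def] A(1)] pi_gt_zero by simp
  next
    case False
    have ge: "ereal (koch_f1 a) \<le> hausdorff_dim A" if a: "0 \<le> a" "a < \<gamma>1" for a
    proof -
      obtain g where g: "g \<in> G" "a < g" using less_cSupD[of G a] a(2) G0 unfolding \<gamma>1_eq by blast
      have "S g \<subseteq> S a" using g(2) by (auto simp: S_def)
      then have "hausdorff_measure 1 (S a) \<noteq> 0"
        using g(1) hausdorff_null_subset[of 1 "S a" "S g"] by (auto simp: G_def)
      then show ?thesis using a small1 unfolding S_def by (intro hausdorff_dim_lower[OF _ _ _ A(1)]) auto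
    qed
    show ?thesis
    proof (rule ereal_le_epsilon2)
      fix e :: real assume "0 < e"
      then obtain d where d: "0 < d" "\<And>x. 0 \<le> x \<Longrightarrow> x < pi / 4 \<Longrightarrow> \<bar>x - \<gamma>1\<bar> < d \<Longrightarrow>
          \<bar>koch_f1 x - koch_f1 \<gamma>1\<bar> < e"
        using koch_f1_near[of \<gamma>1 e] \<gamma>1(1) small1(2) by auto
      define a where "a = max 0 (\<gamma>1 - d / 2)"
      have a: "0 \<le> a" "a < \<gamma>1" "a < pi / 4" "\<bar>a - \<gamma>1\<bar> < d"
        using False \<gamma>1 small1 d(1) by (auto simp: a_def max_def)
      have "ereal (koch_f1 \<gamma>1) \<le> ereal (koch_f1 a) + ereal e" using d(2)[of a] a by simp
      also have "\<dots> \<le> hausdorff_dim A + ereal e" using ge[OF a(1,2)] by (rule add_right_mono)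
      finally show "ereal (koch_f1 \<gamma>1) \<le> hausdorff_dim A + ereal e" .
    qed
  qed

  have upper: "hausdorff_dim A \<le> ereal (koch_f1 \<gamma>2)"
  proof (rule hausdorff_dim_le)
    fix s assume "koch_f1 \<gamma>2 < s"
    then obtain a where a: "\<gamma>2 < a" "0 \<le> a" "a < pi / 4" "koch_f1 a < s"
      using above[OF \<gamma>2(1) small2(2)] by blast
    \<comment> \<open>No limit angle reaches \<open>a\<close>, so nothing remains beyond the
      small-angle subtrees.\<close>
    have "upsilon p a = {}" using limit_angle_le_gamma2 a(1) by (force simp: upsilon_def \<gamma>2_def)
    then have "hausdorff_measure s (cap_limit p) = 0" using a by (intro cap_limit_null) auto
    then show "hausdorff_measure s A = 0" using A(2) by (rule hausdorff_null_subset)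
  qed (use koch_f1_ge_1[OF \<gamma>2(1) small2(2)] in simp)

  have "hausdorff_dim A = ereal (koch_f1 \<gamma>1)"
    if or: "(\<forall>C \<subseteq> base p 0 1. hausdorff_measure 1 C = 0 \<longrightarrow> hausdorff_measure 1 (koch_map p ` C) = 0) \<or>
      hausdorff_measure 1 (upsilon p \<gamma>1) = 0"
  proof (rule antisym[OF hausdorff_dim_le lower])
    show "0 \<le> koch_f1 \<gamma>1" using koch_f1_ge_1[OF \<gamma>1(1) small1(2)] by simp
    fix s assume s: "koch_f1 \<gamma>1 < s"
    then have s1: "1 \<le> s" using koch_f1_ge_1[OF \<gamma>1(1) small1(2)] by simp
    \<comment> \<open>Under the first alternative \<open>a\<close> lies slightly above the critical
      angle, so its parameter set has zero length and so has the image; under the second the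
      critical angle itself serves.\<close>
    have "\<exists>a. 0 \<le> a \<and> a < pi / 4 \<and> koch_f1 a < s \<and> hausdorff_measure 1 (upsilon p a) = 0"
      using or
    proof
      assume null: "\<forall>C \<subseteq> base p 0 1. hausdorff_measure 1 C = 0 \<longrightarrow> hausdorff_measure 1 (koch_map p ` C) = 0"
      obtain a where a: "\<gamma>1 < a" "0 \<le> a" "a < pi / 4" "koch_f1 a < s"
        using above[OF \<gamma>1(1) small1(2) s] by blast
      have "a \<notin> G" using cSup_upper[OF _ bdd, of a] a(1) by (auto simp: \<gamma>1_eq)
      then have "hausdorff_measure 1 (S a) = 0" by (simp add: G_def)
      moreover have "S a \<subseteq> base p 0 1" by (auto simp: S_def)
      ultimately have "hausdorff_measure 1 (upsilon p a) = 0"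
        using null by (simp add: upsilon_def S_def)
      then show ?thesis using a by blast
    qed (use \<gamma>1(1) small1(2) s in blast)
    then obtain a where a: "0 \<le> a" "a < pi / 4" "koch_f1 a < s" "hausdorff_measure 1 (upsilon p a) = 0"
      by blast
    then have "hausdorff_measure s (upsilon p a) = 0"
      using s1 hausdorff_null_exponent_mono[of 1 _ s] by simp
    then have "hausdorff_measure s (cap_limit p) = 0" by (rule cap_limit_null[OF a(1-3)])
    then show "hausdorff_measure s A = 0" using A(2) by (rule hausdorff_null_subset)
  qed
  then show ?thesis
    using lower upper hausdorff_dim_Koch_curve[OF \<gamma>1(1) small1(2,1)]
      hausdorff_dim_Koch_curve[OF \<gamma>2(1) small2(2,1)]
    unfolding \<gamma>1_def \<gamma>2_def by simp
qed

end
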